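(* Assume that $\sum_{n\ge1}\beta_n^\alpha/\gamma_n<\infty$. Then, for any $x\in H$, the Ornstein-Uhlenbeck process $(X_t^x)$ is irreducible, i.e. for any open ball $B\subset H$ and any $t>0$ we have $\mathbb P(X_t^x\in B)>0$.
   Context: Let $H$ be a real separable (infinite-dimensional) Hilbert space with a fixed orthonormal basis $(e_n)_{n\ge1}$; write $x_n=\langle x,e_n\rangle$. Fix $\alpha\in(0,2)$. $(Z^n_t)_{t\ge0}$, $n\ge1$, are independent real normalized symmetric $\alpha$-stable Lévy processes, $\mathbb E[e^{ihZ^n_t}]=e^{-t|h|^\alpha}$, on a stochastic basis $(\Omega,\mathcal F,(\mathcal F_t)_{t\ge0},\mathbb P)$ satisfying the usual assumptions. $(\beta_n)$ is a sequence of positive reals. $A:D(A)\subset H\to H$ is self-adjoint with $e_n\in D(A)$, $Ae_n=-\gamma_ne_n$, $\gamma_n>0$ for all $n\ge 1$, and $\gamma_n\to+\infty$. The Ornstein-Uhlenbeck process starting from $x\in H$ is $X_t^x=\sum_{n\ge1}X_t^ne_n$, $X_t^n=e^{-\gamma_nt}x_n+\int_0^te^{-\gamma_n(t-s)}\beta_n\,dZ^n_s$; under $\sum_n\beta_n^\alpha/\gamma_n<\infty$ it is $H$-valued. *)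

theory Defs
  imports "HOL-Probability.Probability"
begin

text \<open>
  Sequences indexed by $n \ge 1$ in the mathematics are indexed by \<open>nat\<close> here, so index \<open>n\<close>
  stands for the mathematical index $n + 1$.
\<close>

definition orthonormal_basis :: "(nat \<Rightarrow> 'h::real_inner) \<Rightarrow> bool" where
  "orthonormal_basis e \<longleftrightarrow>
     (\<forall>i j. e i \<bullet> e j = (if i = j then 1 else 0)) \<and> closure (span (range e)) = UNIV"

text \<open>
  An unbounded operator is a total function \<open>A\<close> of which only the values on the domain \<open>D\<close> matter.
  The last conjunct says that the graph of the adjoint is the graph of \<open>A\<close>.
\<close>

definition self_adjoint_on :: "'h::real_inner set \<Rightarrow> ('h \<Rightarrow> 'h) \<Rightarrow> bool" where
  "self_adjoint_on D A \<longleftrightarrow>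
     subspace D \<and> closure D = UNIV \<and>
     (\<forall>x\<in>D. \<forall>y\<in>D. A (x + y) = A x + A y) \<and>
     (\<forall>c. \<forall>x\<in>D. A (c *\<^sub>R x) = c *\<^sub>R A x) \<and>
     (\<forall>y z. (\<forall>x\<in>D. A x \<bullet> y = x \<bullet> z) \<longleftrightarrow> y \<in> D \<and> z = A y)"


text \<open>
  Time is \<open>real\<close>; only times \<open>t \<ge> 0\<close> are constrained. The conditions \<open>null_sets_F0\<close>,
  \<open>right_continuous\<close> and completeness of \<open>M\<close> are the usual assumptions.
\<close>

locale stochastic_basis = prob_space M + complete_measure M
  for M :: "'a measure" +
  fixes F :: "real \<Rightarrow> 'a measure"
  assumes subalgebra_F: "0 \<le> t \<Longrightarrow> subalgebra M (F t)"
    and F_mono: "0 \<le> s \<Longrightarrow> s \<le> t \<Longrightarrow> sets (F s) \<subseteq> sets (F t)"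
    and right_continuous: "0 \<le> t \<Longrightarrow> sets (F t) = (\<Inter>s\<in>{t<..}. sets (F s))"
    and null_sets_F0: "null_sets M \<subseteq> sets (F 0)"

locale levy_process = stochastic_basis M F
  for M :: "'a measure" and F :: "real \<Rightarrow> 'a measure" +
  fixes Z :: "real \<Rightarrow> 'a \<Rightarrow> real"
  assumes adapted: "0 \<le> t \<Longrightarrow> Z t \<in> borel_measurable (F t)"
    and starts_at_0: "AE \<omega> in M. Z 0 \<omega> = 0"
    and independent_increments: "0 \<le> s \<Longrightarrow> s \<le> t \<Longrightarrow>
      indep_set (sets (F s)) {(\<lambda>\<omega>. Z t \<omega> - Z s \<omega>) -` B \<inter> space M | B. B \<in> sets borel}"
    and stationary_increments: "0 \<le> s \<Longrightarrow> s \<le> t \<Longrightarrow>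
      distr M borel (\<lambda>\<omega>. Z t \<omega> - Z s \<omega>) = distr M borel (Z (t - s))"
    and stochastically_continuous: "0 \<le> t \<Longrightarrow> 0 < \<epsilon> \<Longrightarrow>
      ((\<lambda>s. prob {\<omega> \<in> space M. \<epsilon> < \<bar>Z s \<omega> - Z t \<omega>\<bar>}) \<longlongrightarrow> 0) (at t within {0..})"
    and cadlag: "AE \<omega> in M. (\<forall>t\<ge>0. continuous (at_right t) (\<lambda>s. Z s \<omega>)) \<and>
      (\<forall>t>0. \<exists>l. ((\<lambda>s. Z s \<omega>) \<longlongrightarrow> l) (at_left t))"

locale symmetric_stable_process = levy_process M F Z
  for M :: "'a measure" and F :: "real \<Rightarrow> 'a measure" and Z :: "real \<Rightarrow> 'a \<Rightarrow> real" +
  fixes \<alpha> :: real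
  assumes char_fun: "0 \<le> t \<Longrightarrow>
    char (distr M borel (Z t)) h = complex_of_real (exp (- t * \<bar>h\<bar> powr \<alpha>))"

text \<open>Independence of whole processes, as random elements of $\mathbb{R}^{[0,\infty)}$.\<close>

definition independent_processes :: "'a measure \<Rightarrow> (nat \<Rightarrow> real \<Rightarrow> 'a \<Rightarrow> real) \<Rightarrow> bool" where
  "independent_processes M Z \<longleftrightarrow>
     prob_space.indep_vars M (\<lambda>n. \<Pi>\<^sub>M t\<in>{0..}. borel) (\<lambda>n \<omega>. \<lambda>t\<in>{0..}. Z n t \<omega>) UNIV"

text \<open>
  $I = \int_0^t f(s)\,dZ_s$ for a deterministic continuous integrand \<open>f\<close>: the limit in
  probability, as the mesh of the partition $0 = p_0 \le \dots \le p_N = t$ tends to 0,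
  of the sums $\sum_{k<N} f(p_k)(Z_{p_{k+1}} - Z_{p_k})$.
\<close>

definition has_stochastic_integral ::
  "'a measure \<Rightarrow> (real \<Rightarrow> real) \<Rightarrow> (real \<Rightarrow> 'a \<Rightarrow> real) \<Rightarrow> real \<Rightarrow> ('a \<Rightarrow> real) \<Rightarrow> bool" where
  "has_stochastic_integral M f Z t I \<longleftrightarrow>
     I \<in> borel_measurable M \<and>
     (\<forall>\<epsilon>>0. \<exists>\<delta>>0. \<forall>N p.
        p 0 = 0 \<and> p N = t \<and> (\<forall>k<N. p k \<le> p (Suc k) \<and> p (Suc k) - p k < \<delta>) \<longrightarrow>
        measure M {\<omega> \<in> space M.
          \<epsilon> < \<bar>(\<Sum>k<N. f (p k) * (Z (p (Suc k)) \<omega> - Z (p k) \<omega>)) - I \<omega>\<bar>} < \<epsilon>)"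

text \<open>The integral is determined up to a null set; an arbitrary version is chosen.\<close>

definition stochastic_integral ::
  "'a measure \<Rightarrow> (real \<Rightarrow> real) \<Rightarrow> (real \<Rightarrow> 'a \<Rightarrow> real) \<Rightarrow> real \<Rightarrow> 'a \<Rightarrow> real" where
  "stochastic_integral M f Z t = (SOME I. has_stochastic_integral M f Z t I)"

definition OU_coord ::
  "'a measure \<Rightarrow> real \<Rightarrow> real \<Rightarrow> (real \<Rightarrow> 'a \<Rightarrow> real) \<Rightarrow> real \<Rightarrow> real \<Rightarrow> 'a \<Rightarrow> real" where
  "OU_coord M \<gamma> \<beta> Z x t \<omega> =
     exp (- \<gamma> * t) * x + stochastic_integral M (\<lambda>s. exp (- \<gamma> * (t - s)) * \<beta>) Z t \<omega>"

definition OU_process ::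
  "'a measure \<Rightarrow> (nat \<Rightarrow> 'h::{real_inner, banach}) \<Rightarrow> (nat \<Rightarrow> real) \<Rightarrow> (nat \<Rightarrow> real) \<Rightarrow>
   (nat \<Rightarrow> real \<Rightarrow> 'a \<Rightarrow> real) \<Rightarrow> 'h \<Rightarrow> real \<Rightarrow> 'a \<Rightarrow> 'h" where
  "OU_process M e \<gamma> \<beta> Z x t \<omega> =
     (\<Sum>n. OU_coord M (\<gamma> n) (\<beta> n) (Z n) (x \<bullet> e n) t \<omega> *\<^sub>R e n)"

text \<open>
  A non-measurable set has \<open>measure\<close> 0, so positivity below includes measurability of the event.
\<close>

definition irreducible_process ::
  "'a measure \<Rightarrow> (real \<Rightarrow> 'a \<Rightarrow> 'h::metric_space) \<Rightarrow> bool" where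
  "irreducible_process M X \<longleftrightarrow>
     (\<forall>c r t. 0 < r \<longrightarrow> 0 < t \<longrightarrow> 0 < measure M {\<omega> \<in> space M. X t \<omega> \<in> ball c r})"

end

theory Submission
  imports Defs
begin

text \<open>
  Each coordinate $\int_0^t e^{-\gamma_n(t-s)}\beta_n\,dZ^n_s$ is symmetric stable with scale
  $c_n = \beta_n^\alpha (1 - e^{-\alpha\gamma_n t})/(\alpha\gamma_n)$, and $\sum_n c_n < \infty$.
  Such a law charges every interval, and its truncated second moment is at most $8 c_n$. So for
  large $N$ the tail $\sum_{n \ge N}$ of the series is small with positive probability, and by
  independence this still holds given that the first $N$ coordinates are close to those of the
  centre of the ball.
\<close>

section \<open>Symmetric stable laws\<close>

text \<open>Since \<alpha> < 2, a coordinate has infinite variance, and the size of the tail cannot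
  be measured by plain second moments; \<open>min 1 (x\<^sup>2)\<close> has a mean of order c_n. The
  truncation is undone pathwise: if such terms sum to less than \<rho> \<le> 1, each of them is
  below 1 and is the plain square. Square summability of the tail, hence convergence of the series
  in H, is thus obtained on the very event considered. The laws are handled through their
  characteristic functions: averaging over a Gaussian frequency gives the moment bound, and the
  behaviour at frequency 0 together with the algebra of stable combinations gives the support. The
  integral is an arbitrary version of a limit in probability. Independence of the driving processes
  reaches the integrals only after each is replaced by a measurable functional of its own path. Head
  and tail are combined by integrating, with values in [0, \<infinity>], the indicator of the head
  event times the truncated tail sum, term by term.\<close>

definition stable_law :: "real \<Rightarrow> real \<Rightarrow> real measure \<Rightarrow> bool" where
  "stable_law \<alpha> c \<mu> \<longleftrightarrow>
     real_distribution \<mu> \<and> (\<forall>h. char \<mu> h = complex_of_real (exp (- c * \<bar>h\<bar> powr \<alpha>)))"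

lemma stable_law_unique:
  assumes "stable_law \<alpha> c \<mu>" "stable_law \<alpha> c \<nu>"
  shows "\<mu> = \<nu>"
  using assms by (intro Levy_uniqueness) (auto simp: stable_law_def)

text \<open>For u at most 1 this follows from \<open>1 + u \<le> exp u\<close>, beyond that from
  \<open>exp (- 1) \<le> 1 / 2\<close>. At u = x^2/2 it turns a Gaussian-type expectation into a
  truncated second moment; at u = c h^\<alpha> it bounds one minus a characteristic function from
  below.\<close>

lemma min_one_le_exp_neg:
  fixes u :: real
  assumes "0 \<le> u"
  shows "min 1 (2 * u) \<le> 4 * (1 - exp (- u))"
proof (cases "u \<le> 1")
  case True
  have "1 + u \<le> exp u" by (rule exp_ge_add_one_self)
  then have "exp (- u) \<le> 1 / (1 + u)"
    using assms by (simp add: exp_minus divide_simps)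
  then have "4 * (1 - exp (- u)) \<ge> 4 * (u / (1 + u))"
    using assms by (simp add: field_simps)
  moreover have "2 * u \<le> 4 * (u / (1 + u))"
    using True assms mult_left_mono[of u 1 u] by (simp add: field_simps)
  ultimately show ?thesis by linarith
next
  case False
  have "exp (- u) \<le> exp (- 1)" using False by simp
  moreover have "exp (- 1 :: real) \<le> 1 / 2"
    using exp_ge_add_one_self[of 1] by (simp add: exp_minus divide_simps)
  ultimately have "exp (- u) \<le> 1 / 2" by (rule order_trans)
  then have "1 \<le> 4 * (1 - exp (- u))" by simp
  then show ?thesis by (rule min.coboundedI1)
qed

text \<open>Serves to bound the moment of order \<alpha> of a standard normal variable by 1 + 1;
  this is the 2 in \<open>1 - 2 * c\<close>.\<close>

lemma powr_le_one_plus_square: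
  fixes g \<alpha> :: real
  assumes "0 < \<alpha>" "\<alpha> < 2"
  shows "\<bar>g\<bar> powr \<alpha> \<le> 1 + g\<^sup>2"
proof (cases "\<bar>g\<bar> \<le> 1")
  case True
  then have "\<bar>g\<bar> powr \<alpha> \<le> 1" using assms by (intro powr_le1) auto
  then show ?thesis by (simp add: add_increasing2)
next
  case False
  then have "\<bar>g\<bar> powr \<alpha> \<le> \<bar>g\<bar> powr 2" using assms by (intro powr_mono) auto
  then show ?thesis using False by simp
qed

text \<open>Integrating the characteristic function against a standard normal law gives
  $\mathbb{E}\, e^{-X^2/2} = \mathbb{E}\, e^{-c|G|^\alpha} \ge 1 - c\,\mathbb{E}|G|^\alpha$.\<close>

lemma stable_law_expectation_exp:
  assumes \<mu>: "stable_law \<alpha> c \<mu>" and \<alpha>: "0 < \<alpha>" "\<alpha> < 2" and c: "0 \<le> c"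
  shows "1 - 2 * c \<le> (\<integral>x. exp (- (x\<^sup>2) / 2) \<partial>\<mu>)"
proof -
  let ?N = std_normal_distribution
  interpret \<mu>: real_distribution \<mu> using \<mu> by (simp add: stable_law_def)
  interpret N: real_distribution ?N by (rule real_dist_normal_dist)
  interpret P: pair_prob_space ?N \<mu> ..
  have [measurable_cong]: "sets \<mu> = sets borel" by simp
  have int: "integrable (?N \<Otimes>\<^sub>M \<mu>) (\<lambda>(g, x). iexp (g * x))"
    by (rule P.integrable_const_bound[where B = 1]) (auto simp: split_beta')
  have "complex_of_real (\<integral>x. exp (- (x\<^sup>2) / 2) \<partial>\<mu>) = (CLINT x|\<mu>. char ?N x)"
    by (simp add: char_std_normal_distribution)
  also have "\<dots> = (CLINT x|\<mu>. CLINT g|?N. iexp (g * x))"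
    by (simp add: char_def mult.commute)
  also have "\<dots> = (CLINT g|?N. CLINT x|\<mu>. iexp (g * x))"
    by (rule P.Fubini_integral[OF int])
  also have "\<dots> = (CLINT g|?N. complex_of_real (exp (- c * \<bar>g\<bar> powr \<alpha>)))"
    using \<mu> by (simp add: stable_law_def char_def)
  finally have eq: "(\<integral>x. exp (- (x\<^sup>2) / 2) \<partial>\<mu>) = (\<integral>g. exp (- c * \<bar>g\<bar> powr \<alpha>) \<partial>?N)"
    by (simp only: integral_complex_of_real of_real_eq_iff)
  have int2: "integrable ?N (\<lambda>g. 1 - c * (1 + g\<^sup>2))"
    using integrable_std_normal_distribution_moment[of 2]
    by (intro Bochner_Integration.integrable_diff integrable_mult_right
        Bochner_Integration.integrable_add) auto
  have "(\<integral>g. 1 - c * (1 + g\<^sup>2) \<partial>?N) = 1 - c * (1 + (\<integral>g. g\<^sup>2 \<partial>?N))"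
    using integrable_std_normal_distribution_moment[of 2] N.prob_space by simp
  also have "(\<integral>g. g\<^sup>2 \<partial>?N) = 1"
    using std_normal_distribution_even_moments(1)[of 1] by (simp add: fact_numeral)
  finally have "1 - 2 * c = (\<integral>g. 1 - c * (1 + g\<^sup>2) \<partial>?N)" by simp
  also have "\<dots> \<le> (\<integral>g. exp (- c * \<bar>g\<bar> powr \<alpha>) \<partial>?N)"
  proof (rule integral_mono[OF int2])
    show "integrable ?N (\<lambda>g. exp (- c * \<bar>g\<bar> powr \<alpha>))"
      by (rule N.integrable_const_bound[where B = 1]) (use c in auto)
    show "1 - c * (1 + g\<^sup>2) \<le> exp (- c * \<bar>g\<bar> powr \<alpha>)" for g
    proof -
      have "c * \<bar>g\<bar> powr \<alpha> \<le> c * (1 + g\<^sup>2)"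
        using powr_le_one_plus_square[OF \<alpha>] c by (intro mult_left_mono) auto
      then show ?thesis using exp_ge_add_one_self[of "- c * \<bar>g\<bar> powr \<alpha>"] by simp
    qed
  qed
  finally show ?thesis using eq by simp
qed

text \<open>The pointwise bound by 4 (1 - e^(-x^2/2)) has mean at most 4 * 2c. Linearity in c makes
  the estimate summable over coordinates and also makes Riemann sums Cauchy in probability.\<close>

lemma stable_law_truncated_second_moment:
  assumes \<mu>: "stable_law \<alpha> c \<mu>" and \<alpha>: "0 < \<alpha>" "\<alpha> < 2" and c: "0 \<le> c"
  shows "(\<integral>x. min 1 (x\<^sup>2) \<partial>\<mu>) \<le> 8 * c"
proof -
  interpret \<mu>: real_distribution \<mu> using \<mu> by (simp add: stable_law_def)
  have [measurable_cong]: "sets \<mu> = sets borel" by simp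
  have int: "integrable \<mu> (\<lambda>x. exp (- (x\<^sup>2) / 2))"
    by (rule \<mu>.integrable_const_bound[where B = 1]) auto
  have "(\<integral>x. min 1 (x\<^sup>2) \<partial>\<mu>) \<le> (\<integral>x. 4 * (1 - exp (- (x\<^sup>2) / 2)) \<partial>\<mu>)"
  proof (rule integral_mono)
    show "integrable \<mu> (\<lambda>x. min 1 (x\<^sup>2))"
      by (rule \<mu>.integrable_const_bound[where B = 1]) auto
    show "min 1 (x\<^sup>2) \<le> 4 * (1 - exp (- (x\<^sup>2) / 2))" for x :: real
      using min_one_le_exp_neg[of "x\<^sup>2 / 2"] by simp
  qed (use int in auto)
  also have "\<dots> = 4 * (1 - (\<integral>x. exp (- (x\<^sup>2) / 2) \<partial>\<mu>))"
    using int \<mu>.prob_space by simp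
  also have "\<dots> \<le> 8 * c"
    using stable_law_expectation_exp[OF assms] by simp
  finally show ?thesis .
qed

text \<open>Strict stability: on the product space the exponents |ha|^\<alpha> and |hb|^\<alpha> add
  up to |h|^\<alpha>, and the characteristic function determines the law. Negative coefficients are
  included.\<close>

lemma stable_law_linear_combination:
  assumes \<mu>: "stable_law \<alpha> c \<mu>" and ab: "\<bar>a\<bar> powr \<alpha> + \<bar>b\<bar> powr \<alpha> = 1"
  shows "distr (\<mu> \<Otimes>\<^sub>M \<mu>) borel (\<lambda>(x, y). a * x + b * y) = \<mu>" (is "?\<nu> = \<mu>")
proof (rule stable_law_unique[OF _ \<mu>])
  interpret \<mu>: real_distribution \<mu> using \<mu> by (simp add: stable_law_def)
  interpret P: pair_prob_space \<mu> \<mu> ..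
  have [measurable_cong]: "sets \<mu> = sets borel" by simp
  have real: "real_distribution ?\<nu>"
    by (intro P.real_distribution_distr) measurable
  have char: "char ?\<nu> h = complex_of_real (exp (- c * \<bar>h\<bar> powr \<alpha>))" for h
  proof -
    have int: "integrable (\<mu> \<Otimes>\<^sub>M \<mu>) (\<lambda>(x, y). iexp (h * a * x) * iexp (h * b * y))"
      by (rule P.integrable_const_bound[where B = 1]) (auto simp: split_beta' norm_mult)
    have "char ?\<nu> h = (CLINT z|\<mu> \<Otimes>\<^sub>M \<mu>. case z of (x, y) \<Rightarrow> iexp (h * a * x) * iexp (h * b * y))"
      unfolding char_def
      by (subst integral_distr)
        (auto simp: split_beta' exp_add[symmetric] algebra_simps intro!: Bochner_Integration.integral_cong)
    also have "\<dots> = (CLINT x|\<mu>. CLINT y|\<mu>. iexp (h * a * x) * iexp (h * b * y))"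
      using P.integral_fst[OF int] by simp
    also have "\<dots> = char \<mu> (h * a) * char \<mu> (h * b)"
      by (simp add: char_def)
    also have "\<dots> = complex_of_real (exp (- c * (\<bar>h * a\<bar> powr \<alpha> + \<bar>h * b\<bar> powr \<alpha>)))"
      using \<mu> by (simp add: stable_law_def exp_add[symmetric] algebra_simps flip: of_real_mult)
    also have "\<bar>h * a\<bar> powr \<alpha> + \<bar>h * b\<bar> powr \<alpha> = \<bar>h\<bar> powr \<alpha> * (\<bar>a\<bar> powr \<alpha> + \<bar>b\<bar> powr \<alpha>)"
      by (simp add: abs_mult powr_mult algebra_simps)
    finally show ?thesis by (simp add: ab)
  qed
  show "stable_law \<alpha> c ?\<nu>" using real char by (simp add: stable_law_def)
qed

text \<open>For a law carried by [-R, R], one minus the characteristic function is at most R^2 h^2,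
  while here it is of order c |h|^\<alpha>, which is larger near 0 because \<alpha> < 2.\<close>

lemma stable_law_unbounded:
  assumes \<mu>: "stable_law \<alpha> c \<mu>" and \<alpha>: "0 < \<alpha>" "\<alpha> < 2" and c: "0 < c"
  shows "\<not> (AE x in \<mu>. \<bar>x\<bar> \<le> R)"
proof
  assume R: "AE x in \<mu>. \<bar>x\<bar> \<le> R"
  interpret \<mu>: real_distribution \<mu> using \<mu> by (simp add: stable_law_def)
  have [measurable_cong]: "sets \<mu> = sets borel" by simp
  have bound: "1 - exp (- c * \<bar>h\<bar> powr \<alpha>) \<le> R\<^sup>2 * h\<^sup>2" for h
  proof -
    have int: "integrable \<mu> (\<lambda>x. iexp (h * x))"
      by (rule \<mu>.integrable_const_bound[where B = 1]) auto
    have "exp (- c * \<bar>h\<bar> powr \<alpha>) = Re (char \<mu> h)"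
      using \<mu> by (simp add: stable_law_def)
    also have "\<dots> = (\<integral>x. cos (h * x) \<partial>\<mu>)"
      using integral_Re[OF int] by (simp add: char_def Re_exp)
    finally have eq: "exp (- c * \<bar>h\<bar> powr \<alpha>) = (\<integral>x. cos (h * x) \<partial>\<mu>)" .
    have intc: "integrable \<mu> (\<lambda>x. cos (h * x))"
      by (rule \<mu>.integrable_const_bound[where B = 1]) auto
    have "1 - exp (- c * \<bar>h\<bar> powr \<alpha>) = (\<integral>x. 1 - cos (h * x) \<partial>\<mu>)"
      using intc \<mu>.prob_space eq by simp
    also have "\<dots> \<le> (\<integral>x. R\<^sup>2 * h\<^sup>2 \<partial>\<mu>)"
    proof (rule integral_mono_AE)
      show "AE x in \<mu>. 1 - cos (h * x) \<le> R\<^sup>2 * h\<^sup>2"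
        using R
      proof eventually_elim
        case (elim x)
        have "1 - cos (h * x) = 2 * (sin (h * x / 2))\<^sup>2"
          using cos_double_sin[of "h * x / 2"] by simp
        also have "(sin (h * x / 2))\<^sup>2 \<le> (h * x / 2)\<^sup>2"
          using abs_sin_x_le_abs_x[of "h * x / 2"] by (simp only: abs_le_square_iff)
        also have "2 * (h * x / 2)\<^sup>2 \<le> (h * x)\<^sup>2"
          by (simp add: power_divide)
        also have "(h * x)\<^sup>2 \<le> R\<^sup>2 * h\<^sup>2"
          using elim abs_le_square_iff[of x R] 
            by (simp add: power_mult_distrib mult.commute[of "R\<^sup>2"] mult_left_mono)
        finally show ?case by simp
      qed
    qed (use intc in auto)
    finally show ?thesis using \<mu>.prob_space by simp
  qed
  have "((\<lambda>h. h powr p) \<longlongrightarrow> 0) (at_right (0::real))" if "0 < p" for p :: real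
    using that by (intro tendsto_zero_powrI[where b = p] tendsto_ident_at tendsto_const
        eventually_mono[OF eventually_at_right_less]) auto
  then have "((\<lambda>h. c * h powr \<alpha>) \<longlongrightarrow> 0) (at_right 0)"
    "((\<lambda>h. 2 * R\<^sup>2 * h powr (2 - \<alpha>)) \<longlongrightarrow> 0) (at_right 0)"
    using \<alpha> by (auto intro!: tendsto_mult_right_zero)
  \<comment> \<open>Under the first threshold the truncation in \<open>min_one_le_exp_neg\<close> is
    inactive; under the second, \<open>bound\<close> divided by \<open>h powr \<alpha>\<close> is
    violated.\<close>
  then have "eventually (\<lambda>h. c * h powr \<alpha> < 1 / 2) (at_right 0)"
    "eventually (\<lambda>h. 2 * R\<^sup>2 * h powr (2 - \<alpha>) < c) (at_right 0)"
    using order_tendstoD(2)[of _ 0 "at_right 0" "1 / 2 :: real"] order_tendstoD(2)[of _ 0 "at_right 0" c] c by auto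
  then have "eventually (\<lambda>h::real. False) (at_right 0)"
    using eventually_at_right_less[of 0]
  proof eventually_elim
    case (elim h)
    have "2 * (c * h powr \<alpha>) \<le> 4 * (1 - exp (- (c * h powr \<alpha>)))"
      using min_one_le_exp_neg[of "c * h powr \<alpha>"] elim c by simp
    also have "\<dots> \<le> 4 * (R\<^sup>2 * h\<^sup>2)"
      using bound[of h] elim by simp
    also have "h\<^sup>2 = h powr \<alpha> * h powr (2 - \<alpha>)"
      using elim by (simp flip: powr_add)
    finally have "c * h powr \<alpha> \<le> (2 * R\<^sup>2 * h powr (2 - \<alpha>)) * h powr \<alpha>"
      by (simp add: algebra_simps)
    then show ?case using elim by simp
  qed
  then show False by simp
qed

text \<open>The support of the law is symmetric, unbounded and stable under the combinations of
  \<open>stable_law_linear_combination\<close>; hence it contains 0 and is star-shaped about 0.\<close>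

lemma stable_law_full_support:
  assumes \<mu>: "stable_law \<alpha> c \<mu>" and \<alpha>: "0 < \<alpha>" "\<alpha> < 2" and c: "0 < c" and \<epsilon>: "0 < \<epsilon>"
  shows "0 < measure \<mu> (ball y \<epsilon>)"
proof -
  interpret \<mu>: real_distribution \<mu> using \<mu> by (simp add: stable_law_def)
  interpret P: pair_prob_space \<mu> \<mu> ..
  have [measurable_cong]: "sets \<mu> = sets borel" by simp
  define S where "S = {x. \<forall>\<epsilon>>0. 0 < measure \<mu> (ball x \<epsilon>)}"
  have comb: "a * x + b * y \<in> S"
    if ab: "\<bar>a\<bar> powr \<alpha> + \<bar>b\<bar> powr \<alpha> = 1" and xy: "x \<in> S" "y \<in> S" for a b x y
    unfolding S_def
  proof (safe)
    fix e :: real assume e: "0 < e"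
    \<comment> \<open>The summand 1 in the denominator makes the estimate |a| d + |b| d < e
      strict.\<close>
    define d where "d = e / (1 + \<bar>a\<bar> + \<bar>b\<bar>)"
    have d: "0 < d" using e by (simp add: d_def add_pos_nonneg)
    \<comment> \<open>Independent copies near \<open>x\<close> and \<open>y\<close> have their
      combination near \<open>a * x + b * y\<close>, and that combination has law \<mu>
      again.\<close>
    have "0 < measure \<mu> (ball x d) * measure \<mu> (ball y d)"
      using xy d by (auto simp: S_def)
    also have "\<dots> = measure (\<mu> \<Otimes>\<^sub>M \<mu>) (ball x d \<times> ball y d)"
      by (simp add: measure_def \<mu>.emeasure_pair_measure_Times enn2real_mult)
    also have "\<dots> \<le> measure (\<mu> \<Otimes>\<^sub>M \<mu>)
        ((\<lambda>(x, y). a * x + b * y) -` ball (a * x + b * y) e \<inter> space (\<mu> \<Otimes>\<^sub>M \<mu>))"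
    proof (rule P.finite_measure_mono)
      show "ball x d \<times> ball y d \<subseteq>
          (\<lambda>(x, y). a * x + b * y) -` ball (a * x + b * y) e \<inter> space (\<mu> \<Otimes>\<^sub>M \<mu>)"
      proof
        fix z assume "z \<in> ball x d \<times> ball y d"
        then obtain u v where z: "z = (u, v)" and uv: "u \<in> ball x d" "v \<in> ball y d" by auto
        have "\<bar>(a * x + b * y) - (a * u + b * v)\<bar> = \<bar>a * (x - u) + b * (y - v)\<bar>"
          by (simp add: algebra_simps)
        also have "\<dots> \<le> \<bar>a\<bar> * \<bar>x - u\<bar> + \<bar>b\<bar> * \<bar>y - v\<bar>"
          by (rule order_trans[OF abs_triangle_ineq]) (simp add: abs_mult)
        also have "\<dots> \<le> \<bar>a\<bar> * d + \<bar>b\<bar> * d"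
          using uv by (intro add_mono mult_left_mono) (auto simp: dist_real_def)
        also have "\<dots> < (1 + \<bar>a\<bar> + \<bar>b\<bar>) * d"
          using d by (simp add: algebra_simps)
        also have "\<dots> = e" by (simp add: d_def add_pos_nonneg less_imp_neq)
        finally show "z \<in> (\<lambda>(x, y). a * x + b * y) -` ball (a * x + b * y) e \<inter> space (\<mu> \<Otimes>\<^sub>M \<mu>)"
          by (simp add: z dist_real_def space_pair_measure)
      qed
    qed measurable
    also have "\<dots> = measure (distr (\<mu> \<Otimes>\<^sub>M \<mu>) borel (\<lambda>(x, y). a * x + b * y)) (ball (a * x + b * y) e)"
      by (rule measure_distr[symmetric]) auto
    also have "\<dots> = measure \<mu> (ball (a * x + b * y) e)"
      by (simp only: stable_law_linear_combination[OF \<mu> ab])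
    finally show "0 < measure \<mu> (ball (a * x + b * y) e)" .
  qed
  have unbounded: "\<exists>x\<in>S. R < \<bar>x\<bar>" for R
  proof (rule ccontr)
    assume neg: "\<not> (\<exists>x\<in>S. R < \<bar>x\<bar>)"
    \<comment> \<open>Points outside \<open>S\<close> lie in null open sets. The union of all null
      open sets is null, by passing to a countable subfamily with the same union; so \<mu> would be
      carried by [-R, R].\<close>
    define \<F> where "\<F> = {B. open B \<and> measure \<mu> B = 0}"
    obtain \<F>' where F': "\<F>' \<subseteq> \<F>" "countable \<F>'" "\<Union>\<F>' = \<Union>\<F>"
      by (rule Lindelof[of \<F>]) (auto simp: \<F>_def)
    have "AE x in \<mu>. \<forall>B\<in>\<F>'. x \<notin> B"
    proof (rule AE_ball_countable'[OF _ F'(2)])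
      fix B assume "B \<in> \<F>'"
      then have B: "open B" "measure \<mu> B = 0" using F' by (auto simp: \<F>_def)
      then have "B \<in> null_sets \<mu>" by (auto simp: null_sets_def \<mu>.emeasure_eq_measure)
      then show "AE x in \<mu>. x \<notin> B" by (rule AE_not_in)
    qed
    then have "AE x in \<mu>. \<bar>x\<bar> \<le> R"
    proof eventually_elim
      case (elim x)
      show ?case
      proof (rule ccontr)
        assume "\<not> \<bar>x\<bar> \<le> R"
        then have "x \<notin> S" using neg by auto
        then obtain e where "0 < e" "measure \<mu> (ball x e) = 0"
          using measure_nonneg[of \<mu>] by (auto simp: S_def less_le)
        then have "ball x e \<in> \<F>" "x \<in> ball x e" by (auto simp: \<F>_def)
        then show False using elim F' by blast
      qed
    qed
    then show False using stable_law_unbounded[OF \<mu> \<alpha> c] by blast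
  qed
  have uminus: "- x \<in> S" if "x \<in> S" for x
    using comb[of "- 1" 0 x x] that \<alpha> by simp
  obtain x where x: "x \<in> S" "\<bar>y\<bar> < \<bar>x\<bar>" using unbounded by blast
  have half: "\<bar>(1/2) powr (1/\<alpha>)\<bar> powr \<alpha> = 1/2" using \<alpha> by (simp add: powr_powr)
  \<comment> \<open>With equal coefficients 2^(-1/\<alpha>) the points \<open>x\<close> and
    \<open>- x\<close> combine to 0.\<close>
  have "(1/2) powr (1/\<alpha>) * x + (1/2) powr (1/\<alpha>) * (- x) \<in> S"
    using half by (intro comb x uminus) auto
  then have zero: "0 \<in> S" by simp
  define s where "s = y / x"
  have s: "\<bar>s\<bar> \<le> 1" using x by (simp add: s_def abs_divide)
  \<comment> \<open>\<open>r\<close> completes \<open>s\<close> to an admissible pair of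
    coefficients; paired with the support point 0 it leaves exactly
    \<open>s * x = y\<close>.\<close>
  define r where "r = (1 - \<bar>s\<bar> powr \<alpha>) powr (1/\<alpha>)"
  have "\<bar>s\<bar> powr \<alpha> \<le> 1" using s \<alpha> by (intro powr_le1) auto
  then have "\<bar>r\<bar> powr \<alpha> = 1 - \<bar>s\<bar> powr \<alpha>" using \<alpha> by (simp add: r_def powr_powr)
  then have "s * x + r * 0 \<in> S" using x zero by (intro comb) auto
  then have "y \<in> S" using x by (simp add: s_def split: if_splits)
  then show ?thesis using \<epsilon> by (simp add: S_def)
qed

section \<open>Riemann sums of stable processes\<close>

lemma sum_indicator_increments:
  fixes z r :: "_ \<Rightarrow> real"
  assumes r: "strict_mono_on {..n} r" and j: "j \<le> (n::nat)"
  shows "(\<Sum>i<n. of_bool (r i < r j) * (z (r (Suc i)) - z (r i))) = z (r j) - z (r 0)"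
proof -
  have "(\<Sum>i<n. of_bool (r i < r j) * (z (r (Suc i)) - z (r i)))
      = (\<Sum>i<n. if i < j then z (r (Suc i)) - z (r i) else 0)"
    using j strict_mono_on_less[OF r] by (intro sum.cong) auto
  also have "\<dots> = (\<Sum>i<j. z (r (Suc i)) - z (r i))"
    using j by (intro sum.mono_neutral_cong_right) auto
  also have "\<dots> = z (r j) - z (r 0)"
    by (rule sum_lessThan_telescope)
  finally show ?thesis .
qed

text \<open>The argument is a path, not a random variable, so the same expression can be evaluated
  at a sample path and read as a measurable function on the product space of paths.\<close>

definition riemann_sum :: "(real \<Rightarrow> real) \<Rightarrow> nat \<Rightarrow> (nat \<Rightarrow> real) \<Rightarrow> (real \<Rightarrow> real) \<Rightarrow> real" where
  "riemann_sum f N p z = (\<Sum>k<N. f (p k) * (z (p (Suc k)) - z (p k)))"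

definition fine_partition :: "real \<Rightarrow> real \<Rightarrow> nat \<Rightarrow> (nat \<Rightarrow> real) \<Rightarrow> bool" where
  "fine_partition t \<delta> N p \<longleftrightarrow>
     p 0 = 0 \<and> p N = t \<and> (\<forall>k<N. p k \<le> p (Suc k) \<and> p (Suc k) - p k < \<delta>)"

lemma fine_partition_mono:
  assumes "fine_partition t \<delta> N p" "i \<le> j" "j \<le> N"
  shows "p i \<le> p j"
  using assms(2,3)
proof (induction j rule: dec_induct)
  case (step k)
  then have "p i \<le> p k" "p k \<le> p (Suc k)" using assms(1) by (auto simp: fine_partition_def)
  then show ?case by simp
qed simp

lemma fine_partition_range:
  assumes "fine_partition t \<delta> N p" "k \<le> N"
  shows "0 \<le> p k" "p k \<le> t"
  using fine_partition_mono[OF assms(1), of 0 k] fine_partition_mono[OF assms(1), of k N] assms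
  by (auto simp: fine_partition_def)

text \<open>The left-endpoint step function, with value \<open>f (p k)\<close> where
  \<open>p k \<le> s < p (Suc k)\<close>. Differences of indicators absorb repeated nodes and fit
  the telescoping in \<open>sum_indicator_increments\<close>.\<close>

definition step_fun :: "(real \<Rightarrow> real) \<Rightarrow> nat \<Rightarrow> (nat \<Rightarrow> real) \<Rightarrow> real \<Rightarrow> real" where
  "step_fun f N p s = (\<Sum>k<N. f (p k) * (of_bool (s < p (Suc k)) - of_bool (s < p k)))"

text \<open>Each increment over a cell of \<open>p\<close> telescopes over the grid
  \<open>r\<close>, and exchanging the sums collects the coefficient of every grid increment. Two
  Riemann sums thus become combinations of the same increments, and so does their
  difference.\<close>

lemma riemann_sum_refine:
  assumes p: "p ` {..N} \<subseteq> r ` {..n}" and r: "strict_mono_on {..n} r"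
  shows "riemann_sum f N p z = (\<Sum>i<n. step_fun f N p (r i) * (z (r (Suc i)) - z (r i)))"
proof -
  have incr: "(\<Sum>i<n. of_bool (r i < p k) * (z (r (Suc i)) - z (r i))) = z (p k) - z (r 0)"
    if k: "k \<le> N" for k
  proof -
    obtain j where "j \<le> n" "p k = r j" using p k by force
    then show ?thesis using sum_indicator_increments[OF r] by simp
  qed
  have "(\<Sum>i<n. step_fun f N p (r i) * (z (r (Suc i)) - z (r i)))
      = (\<Sum>i<n. \<Sum>k<N. f (p k) * (of_bool (r i < p (Suc k)) * (z (r (Suc i)) - z (r i))
          - of_bool (r i < p k) * (z (r (Suc i)) - z (r i))))"
    unfolding step_fun_def sum_distrib_right by (intro sum.cong refl) (simp add: algebra_simps)
  also have "\<dots> = (\<Sum>k<N. f (p k) * ((\<Sum>i<n. of_bool (r i < p (Suc k)) * (z (r (Suc i)) - z (r i)))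
          - (\<Sum>i<n. of_bool (r i < p k) * (z (r (Suc i)) - z (r i)))))"
    by (subst sum.swap) (simp only: sum_distrib_left sum_subtractf[symmetric])
  also have "\<dots> = riemann_sum f N p z"
    unfolding riemann_sum_def
  proof (rule sum.cong[OF refl])
    fix k assume "k \<in> {..<N}"
    then have k: "k \<le> N" "Suc k \<le> N" by auto
    show "f (p k) * ((\<Sum>i<n. of_bool (r i < p (Suc k)) * (z (r (Suc i)) - z (r i)))
          - (\<Sum>i<n. of_bool (r i < p k) * (z (r (Suc i)) - z (r i))))
        = f (p k) * (z (p (Suc k)) - z (p k))"
      unfolding incr[OF k(1)] incr[OF k(2)] by simp
  qed
  finally show ?thesis ..
qed

text \<open>The weights \<open>w\<close> are non-negative with sum 1, so the step function is a
  convex combination of values \<open>f (p k)\<close>. A positive weight puts \<open>s\<close> in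
  the k-th cell, to the right of \<open>p k\<close> and less than \<delta> away.\<close>

lemma step_fun_approx:
  assumes p: "fine_partition t \<delta> N p" and s: "0 \<le> s" "s < t" and \<eta>: "0 \<le> \<eta>"
    and f: "\<And>u. 0 \<le> u \<Longrightarrow> u \<le> s \<Longrightarrow> s - u < \<delta> \<Longrightarrow> \<bar>f u - f s\<bar> \<le> \<eta>"
  shows "\<bar>step_fun f N p s - f s\<bar> \<le> \<eta>"
proof -
  define w :: "nat \<Rightarrow> real" where "w k = of_bool (s < p (Suc k)) - of_bool (s < p k)" for k
  have "(\<Sum>k<N. w k) = of_bool (s < p N) - of_bool (s < p 0)"
    unfolding w_def by (rule sum_lessThan_telescope)
  then have sum_w: "(\<Sum>k<N. w k) = 1" using p s by (simp add: fine_partition_def)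
  have w: "0 \<le> w k" "\<bar>f (p k) - f s\<bar> * w k \<le> \<eta> * w k" if k: "k < N" for k
  proof -
    have pk: "p k \<le> p (Suc k)" "p (Suc k) - p k < \<delta>" "0 \<le> p k"
      using p k fine_partition_range[OF p, of k] by (auto simp: fine_partition_def)
    then show "0 \<le> w k" "\<bar>f (p k) - f s\<bar> * w k \<le> \<eta> * w k"
      using f[of "p k"] by (auto simp: w_def)
  qed
  have "step_fun f N p s - f s = (\<Sum>k<N. f (p k) * w k) - f s * (\<Sum>k<N. w k)"
    by (simp only: sum_w) (simp add: step_fun_def w_def)
  also have "\<dots> = (\<Sum>k<N. (f (p k) - f s) * w k)"
    by (simp add: sum_subtractf algebra_simps sum_distrib_left)
  finally have "\<bar>step_fun f N p s - f s\<bar> \<le> (\<Sum>k<N. \<bar>(f (p k) - f s) * w k\<bar>)"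
    by (simp only: sum_abs)
  also have "\<dots> \<le> (\<Sum>k<N. \<eta> * w k)"
    using w by (intro sum_mono) (simp add: abs_mult)
  also have "\<dots> = \<eta>" by (simp add: sum_distrib_left[symmetric] sum_w)
  finally show ?thesis .
qed

text \<open>Sorting the set of all nodes merges the partitions and removes the repetitions that
  \<open>fine_partition\<close> permits, so the grid is strictly increasing.\<close>

lemma common_refinement:
  assumes p: "fine_partition t \<delta> N p" and q: "fine_partition t \<delta>' N' q"
  obtains n :: nat and r :: "nat \<Rightarrow> real" where "strict_mono_on {..n} r" "r 0 = 0" "r n = t"
    "p ` {..N} \<subseteq> r ` {..n}" "q ` {..N'} \<subseteq> r ` {..n}"
proof -
  define A where "A = p ` {..N} \<union> q ` {..N'}"
  define xs where "xs = sorted_list_of_set A"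
  \<comment> \<open>The last index, not the length: the grid runs from \<open>xs ! 0\<close> to
    \<open>xs ! n\<close>.\<close>
  define n where "n = length xs - 1"
  have A: "finite A" "0 \<in> A" "t \<in> A" "\<And>a. a \<in> A \<Longrightarrow> 0 \<le> a \<and> a \<le> t"
    using fine_partition_range[OF p] fine_partition_range[OF q] p
    by (auto simp: A_def fine_partition_def image_iff)
  have xs: "set xs = A" "sorted_wrt (<) xs" using A 
    by (auto simp: xs_def strict_sorted_list_of_set)
  then have ne: "xs \<noteq> []" using A by auto
  then have idx: "i \<le> n \<longleftrightarrow> i < length xs" for i
    unfolding n_def by (cases xs) auto
  have img: "(!) xs ` {..n} = A"
    unfolding xs(1)[symmetric] by (force simp: set_conv_nth idx)
  have mono: "strict_mono_on {..n} ((!) xs)"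
    using sorted_wrt_nth_less[OF xs(2)] by (intro strict_mono_onI) (simp add: idx)
  have le: "xs ! i \<le> xs ! j" if "i \<le> j" "j \<le> n" for i j
    using that strict_mono_on_leD[OF mono] by auto
  obtain i0 i1 where i: "i0 \<le> n" "i1 \<le> n" "xs ! i0 = 0" "xs ! i1 = t"
    using A(2,3) img by (metis atMost_iff imageE)
  have "xs ! 0 \<in> A" "xs ! n \<in> A" using img by auto
  then have "xs ! 0 = 0" "xs ! n = t"
    using A(4)[of "xs ! 0"] A(4)[of "xs ! n"] le[of 0 i0] le[of i1 n] i by auto
  then show thesis
    using that[of n "(!) xs"] mono img by (auto simp: A_def)
qed

section \<open>Laws of weighted sums of increments\<close>

context symmetric_stable_process
begin

lemma measurable_F:
  assumes "0 \<le> s" "s \<le> t" shows "Z s \<in> borel_measurable (F t)"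
proof -
  have "space (F s) = space (F t)"
    using subalgebra_F[of s] subalgebra_F[of t] assms by (simp add: subalgebra_def)
  then show ?thesis
    using adapted[OF assms(1)] F_mono[OF assms] by (auto simp: measurable_def)
qed

lemma measurable_Z: "0 \<le> s \<Longrightarrow> Z s \<in> borel_measurable M"
  using adapted[of s] subalgebra_F[of s] measurable_from_subalg by blast

lemma indep_var_increment:
  assumes X: "X \<in> borel_measurable (F s)" and s: "0 \<le> s" "s \<le> t"
  shows "indep_var borel X borel (\<lambda>\<omega>. a * (Z t \<omega> - Z s \<omega>))"
proof -
  let ?D = "\<lambda>\<omega>. Z t \<omega> - Z s \<omega>"
  have [measurable]: "X \<in> borel_measurable M"
    using X subalgebra_F[OF s(1)] measurable_from_subalg by blast
  have [measurable]: "Z s \<in> borel_measurable M" "Z t \<in> borel_measurable M"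
    using measurable_Z s by auto
  have sp: "space (F s) = space M"
    using subalgebra_F[OF s(1)] by (simp add: subalgebra_def)
  have "{X -` A \<inter> space M |A. A \<in> sets borel} \<subseteq> sets (F s)"
    unfolding sp[symmetric] using measurable_sets[OF X] by auto
  moreover have "indep_set (sets (F s)) {?D -` A \<inter> space M |A. A \<in> sets borel}"
    by (rule independent_increments[OF s])
  ultimately have "indep_set {X -` A \<inter> space M |A. A \<in> sets borel} {?D -` A \<inter> space M |A. A \<in> sets borel}"
    unfolding indep_sets2_eq by blast
  then have "indep_sets (\<lambda>i. {(case i of True \<Rightarrow> X | False \<Rightarrow> ?D) -` A \<inter> space M |A.
      A \<in> sets (case i of True \<Rightarrow> borel | False \<Rightarrow> borel)}) UNIV"
    unfolding indep_set_def by (rule indep_sets_mono_sets) (auto split: bool.split)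
  then have "indep_var borel X borel ?D"
    unfolding indep_var_def indep_vars_def2 by (auto split: bool.split)
  then have "indep_var borel ((\<lambda>x. x) \<circ> X) borel ((\<lambda>x. a * x) \<circ> ?D)"
    by (rule indep_var_compose) auto
  then show ?thesis by (simp add: comp_def)
qed

lemma char_increment:
  assumes "0 \<le> s" "s \<le> t"
  shows "char (distr M borel (\<lambda>\<omega>. a * (Z t \<omega> - Z s \<omega>))) h
    = complex_of_real (exp (- (\<bar>a\<bar> powr \<alpha> * (t - s)) * \<bar>h\<bar> powr \<alpha>))"
proof -
  have [measurable]: "Z s \<in> borel_measurable M" "Z t \<in> borel_measurable M"
    using measurable_Z assms by auto
  have "char (distr M borel (\<lambda>\<omega>. a * (Z t \<omega> - Z s \<omega>))) h
      = char (distr M borel (\<lambda>\<omega>. Z t \<omega> - Z s \<omega>)) (h * a)"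
    unfolding char_def by (subst (1 2) integral_distr) (auto simp: mult.assoc)
  also have "\<dots> = complex_of_real (exp (- (t - s) * \<bar>h * a\<bar> powr \<alpha>))"
    using assms by (simp only: stationary_increments char_fun)
  finally show ?thesis by (simp add: abs_mult powr_mult algebra_simps)
qed

text \<open>Measurability with respect to \<open>F (r n)\<close>, and not only \<open>M\<close>, is
  the point: it makes the partial sum independent of the next increment.\<close>

lemma measurable_increments:
  assumes "0 \<le> r 0" "\<And>i. i < n \<Longrightarrow> r i \<le> r (Suc i)"
  shows "(\<lambda>\<omega>. \<Sum>i<n. a i * (Z (r (Suc i)) \<omega> - Z (r i) \<omega>)) \<in> borel_measurable (F (r n))"
    "0 \<le> r n"
proof -
  have mono: "r i \<le> r j" if "i \<le> j" "j \<le> n" for i j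
    using that
  proof (induction j rule: dec_induct)
    case (step j)
    then show ?case using assms(2)[of j] by simp
  qed simp
  have "0 \<le> r i \<and> r i \<le> r n" if "i \<le> n" for i
    using mono[of 0 i] mono[of i n] assms(1) that by auto
  then show "(\<lambda>\<omega>. \<Sum>i<n. a i * (Z (r (Suc i)) \<omega> - Z (r i) \<omega>)) \<in> borel_measurable (F (r n))"
    "0 \<le> r n"
    by (auto intro!: borel_measurable_sum borel_measurable_times borel_measurable_diff measurable_F)
qed

text \<open>Induction peels off the last increment, which is independent of the preceding partial
  sum; characteristic functions multiply and exponents add.\<close>

lemma stable_law_increments:
  assumes "0 \<le> r 0" "\<And>i. i < n \<Longrightarrow> r i \<le> r (Suc i)"
  shows "stable_law \<alpha> (\<Sum>i<n. \<bar>a i\<bar> powr \<alpha> * (r (Suc i) - r i))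
       (distr M borel (\<lambda>\<omega>. \<Sum>i<n. a i * (Z (r (Suc i)) \<omega> - Z (r i) \<omega>)))"
proof -
  have "(\<lambda>\<omega>. \<Sum>i<n. a i * (Z (r (Suc i)) \<omega> - Z (r i) \<omega>)) \<in> borel_measurable M"
    using measurable_increments[OF assms] subalgebra_F measurable_from_subalg by blast
  then have real: "real_distribution (distr M borel (\<lambda>\<omega>. \<Sum>i<n. a i * (Z (r (Suc i)) \<omega> - Z (r i) \<omega>)))"
    by (rule real_distribution_distr)
  have exp_mult_exp: "exp (- u * w) * exp (- v * w) = exp (- (u + v) * w)" for u v w :: real
    by (simp only: exp_add[symmetric] distrib_right minus_add_distrib)
  have "char (distr M borel (\<lambda>\<omega>. \<Sum>i<n. a i * (Z (r (Suc i)) \<omega> - Z (r i) \<omega>))) h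
      = complex_of_real (exp (- (\<Sum>i<n. \<bar>a i\<bar> powr \<alpha> * (r (Suc i) - r i)) * \<bar>h\<bar> powr \<alpha>))" for h
    using assms
  proof (induction n)
    case 0
    then show ?case by (simp add: char_def integral_distr prob_space del: distr_const)
  next
    case (Suc n)
    have r: "0 \<le> r n" "r n \<le> r (Suc n)"
      using measurable_increments(2)[of r n] Suc.prems by auto
    have "indep_var borel (\<lambda>\<omega>. \<Sum>i<n. a i * (Z (r (Suc i)) \<omega> - Z (r i) \<omega>))
        borel (\<lambda>\<omega>. a n * (Z (r (Suc n)) \<omega> - Z (r n) \<omega>))"
      using Suc.prems r by (intro indep_var_increment measurable_increments(1)) auto
    note add = char_distr_add[OF this, of h]
    have ih: "char (distr M borel (\<lambda>\<omega>. \<Sum>i<n. a i * (Z (r (Suc i)) \<omega> - Z (r i) \<omega>))) h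
        = complex_of_real (exp (- (\<Sum>i<n. \<bar>a i\<bar> powr \<alpha> * (r (Suc i) - r i)) * \<bar>h\<bar> powr \<alpha>))"
      by (rule Suc.IH) (use Suc.prems in auto)
    have "char (distr M borel (\<lambda>\<omega>. \<Sum>i<Suc n. a i * (Z (r (Suc i)) \<omega> - Z (r i) \<omega>))) h
        = complex_of_real (exp (- (\<Sum>i<n. \<bar>a i\<bar> powr \<alpha> * (r (Suc i) - r i)) * \<bar>h\<bar> powr \<alpha>)) *
          complex_of_real (exp (- (\<bar>a n\<bar> powr \<alpha> * (r (Suc n) - r n)) * \<bar>h\<bar> powr \<alpha>))"
      using add unfolding sum.lessThan_Suc ih char_increment[OF r] .
    also have "\<dots> = complex_of_real (exp (- (\<Sum>i<Suc n. \<bar>a i\<bar> powr \<alpha> * (r (Suc i) - r i)) * \<bar>h\<bar> powr \<alpha>))"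
      by (simp only: of_real_mult[symmetric] exp_mult_exp sum.lessThan_Suc)
    finally show ?case .
  qed
  then show ?thesis unfolding stable_law_def using real by blast
qed

end

section \<open>Convergence in probability\<close>

context prob_space
begin

lemma AE_tendsto_imp_tendsto_prob:
  fixes X :: "nat \<Rightarrow> 'a \<Rightarrow> real"
  assumes [measurable]: "\<And>k. X k \<in> borel_measurable M" "Y \<in> borel_measurable M"
    and lim: "AE \<omega> in M. (\<lambda>k. X k \<omega>) \<longlonglongrightarrow> Y \<omega>" and \<epsilon>: "0 < \<epsilon>"
  shows "(\<lambda>k. prob {\<omega> \<in> space M. \<epsilon> < \<bar>X k \<omega> - Y \<omega>\<bar>}) \<longlonglongrightarrow> 0"
proof -
  let ?A = "\<lambda>k. {\<omega> \<in> space M. \<epsilon> < \<bar>X k \<omega> - Y \<omega>\<bar>}"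
  have "(\<lambda>k. \<integral>\<omega>. indicator (?A k) \<omega> \<partial>M) \<longlonglongrightarrow> (\<integral>\<omega>. (0::real) \<partial>M)"
  proof (rule integral_dominated_convergence[where w = "\<lambda>_. 1"])
    show "AE \<omega> in M. (\<lambda>k. indicator (?A k) \<omega> :: real) \<longlonglongrightarrow> 0"
      using lim
    proof eventually_elim
      case (elim \<omega>)
      then have "eventually (\<lambda>k. dist (X k \<omega>) (Y \<omega>) < \<epsilon>) sequentially"
        using \<epsilon> by (rule tendstoD)
      then have "eventually (\<lambda>k. indicator (?A k) \<omega> = (0::real)) sequentially"
        by eventually_elim (auto simp: dist_real_def)
      then show ?case by (rule tendsto_eventually)
    qed
  qed (auto simp: indicator_def)
  then show ?thesis by simp
qed

text \<open>By Borel-Cantelli, almost surely all but finitely many increments are at most 2^(-k), so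
  the telescoping series converges absolutely.\<close>

lemma AE_convergent_if_prob_increments:
  fixes X :: "nat \<Rightarrow> 'a \<Rightarrow> real"
  assumes [measurable]: "\<And>k. X k \<in> borel_measurable M"
    and le: "\<And>k. prob {\<omega> \<in> space M. (1/2) ^ k < \<bar>X (Suc k) \<omega> - X k \<omega>\<bar>} \<le> (1/2) ^ k"
  shows "AE \<omega> in M. convergent (\<lambda>k. X k \<omega>)"
proof -
  let ?A = "\<lambda>k. {\<omega> \<in> space M. (1/2) ^ k < \<bar>X (Suc k) \<omega> - X k \<omega>\<bar>}"
  have geo: "summable (\<lambda>k. (1/2::real) ^ k)" by (rule summable_geometric) simp
  have "summable (\<lambda>k. prob (?A k))"
    using le by (intro summable_comparison_test[OF _ geo]) auto
  then have "AE \<omega> in M. eventually (\<lambda>k. \<omega> \<in> space M - ?A k) sequentially"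
    by (intro borel_cantelli_AE1) (auto simp: emeasure_eq_measure)
  then show ?thesis
  proof eventually_elim
    case (elim \<omega>)
    then have "eventually (\<lambda>k. norm (X (Suc k) \<omega> - X k \<omega>) \<le> (1/2) ^ k) sequentially"
      by eventually_elim auto
    then have "summable (\<lambda>k. X (Suc k) \<omega> - X k \<omega>)"
      using geo by (rule summable_comparison_test_ev)
    then have "convergent (\<lambda>n. X n \<omega> - X 0 \<omega>)"
      unfolding summable_iff_convergent sum_lessThan_telescope[of "\<lambda>k. X k \<omega>"] .
    then show ?case using convergent_add[OF _ convergent_const[of "X 0 \<omega>"]] by fastforce
  qed
qed

lemma prob_triangle:
  fixes X Y W :: "'a \<Rightarrow> real"
  assumes [measurable]: "X \<in> borel_measurable M" "Y \<in> borel_measurable M" "W \<in> borel_measurable M"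
  shows "prob {\<omega> \<in> space M. a + b < \<bar>X \<omega> - W \<omega>\<bar>}
    \<le> prob {\<omega> \<in> space M. a < \<bar>X \<omega> - Y \<omega>\<bar>} + prob {\<omega> \<in> space M. b < \<bar>Y \<omega> - W \<omega>\<bar>}"
proof -
  have "prob {\<omega> \<in> space M. a + b < \<bar>X \<omega> - W \<omega>\<bar>}
      \<le> prob ({\<omega> \<in> space M. a < \<bar>X \<omega> - Y \<omega>\<bar>} \<union> {\<omega> \<in> space M. b < \<bar>Y \<omega> - W \<omega>\<bar>})"
    by (intro finite_measure_mono) auto
  also have "\<dots> \<le> prob {\<omega> \<in> space M. a < \<bar>X \<omega> - Y \<omega>\<bar>} + prob {\<omega> \<in> space M. b < \<bar>Y \<omega> - W \<omega>\<bar>}"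
    by (intro measure_Un_le) auto
  finally show ?thesis .
qed

lemma AE_eq_if_prob_small:
  fixes X Y :: "'a \<Rightarrow> real"
  assumes [measurable]: "X \<in> borel_measurable M" "Y \<in> borel_measurable M"
    and small: "\<And>\<epsilon>. 0 < \<epsilon> \<Longrightarrow> prob {\<omega> \<in> space M. \<epsilon> < \<bar>X \<omega> - Y \<omega>\<bar>} \<le> \<epsilon>"
  shows "AE \<omega> in M. X \<omega> = Y \<omega>"
proof -
  have "AE \<omega> in M. \<bar>X \<omega> - Y \<omega>\<bar> \<le> inverse (real (Suc n))" for n
  proof -
    let ?A = "\<lambda>e. {\<omega> \<in> space M. e < \<bar>X \<omega> - Y \<omega>\<bar>}"
    have "prob (?A (inverse (real (Suc n)))) \<le> 0"
    \<comment> \<open>The hypothesis ties level and probability together. Lowering the level to at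
      most \<open>e\<close> only enlarges the event, so the probability at the fixed level is below
      every \<open>e\<close>.\<close>
    proof (rule field_le_epsilon)
      fix e :: real assume e: "0 < e"
      have "prob (?A (inverse (real (Suc n)))) \<le> prob (?A (min e (inverse (real (Suc n)))))"
        by (intro finite_measure_mono) auto
      also have "\<dots> \<le> min e (inverse (real (Suc n)))" using e by (intro small) simp
      finally show "prob (?A (inverse (real (Suc n)))) \<le> 0 + e" by simp
    qed
    then have "prob (?A (inverse (real (Suc n)))) = 0"
      using measure_nonneg by (rule antisym)
    then have "?A (inverse (real (Suc n))) \<in> null_sets M"
      by (auto simp: null_sets_def emeasure_eq_measure)
    then show ?thesis by (rule AE_I') auto
  qed
  then have "AE \<omega> in M. \<forall>n. \<bar>X \<omega> - Y \<omega>\<bar> \<le> inverse (real (Suc n))"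
    by (simp add: AE_all_countable)
  then show ?thesis
  proof eventually_elim
    case (elim \<omega>)
    have "\<bar>X \<omega> - Y \<omega>\<bar> \<le> 0"
      using elim LIMSEQ_le_const[OF LIMSEQ_inverse_real_of_nat] by blast
    then show ?case by simp
  qed
qed

text \<open>The map from x to e^(ihx) is Lipschitz with constant |h| and has modulus 1. The
  Lipschitz bound serves where \<open>X k\<close> is within \<epsilon> of \<open>Y\<close>, the
  bound 2 on the remaining event of probability below \<epsilon>.\<close>

lemma tendsto_char_if_tendsto_prob:
  fixes X :: "nat \<Rightarrow> 'a \<Rightarrow> real"
  assumes [measurable]: "\<And>k. X k \<in> borel_measurable M" "Y \<in> borel_measurable M"
    and lim: "\<And>\<epsilon>. 0 < \<epsilon> \<Longrightarrow> eventually (\<lambda>k. prob {\<omega> \<in> space M. \<epsilon> < \<bar>X k \<omega> - Y \<omega>\<bar>} < \<epsilon>) sequentially"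
  shows "(\<lambda>k. char (distr M borel (X k)) h) \<longlonglongrightarrow> char (distr M borel Y) h"
proof (rule tendstoI)
  have lip: "cmod (iexp (h * x) - iexp (h * y)) \<le> \<bar>h\<bar> * \<epsilon> + 2 * of_bool (\<epsilon> < \<bar>x - y\<bar>)"
    if "0 \<le> \<epsilon>" for x y \<epsilon>
  proof (cases "\<epsilon> < \<bar>x - y\<bar>")
    case True
    have "cmod (iexp (h * x) - iexp (h * y)) \<le> cmod (iexp (h * x)) + cmod (iexp (h * y))"
      by (rule norm_triangle_ineq4)
    also have "\<dots> \<le> \<bar>h\<bar> * \<epsilon> + 2 * of_bool (\<epsilon> < \<bar>x - y\<bar>)" using True that by simp
    finally show ?thesis .
  next
    case False
    have "iexp (h * x) - iexp (h * y) = iexp (h * y) * (iexp (h * (x - y)) - 1)"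
      by (simp add: algebra_simps exp_add[symmetric])
    then have "cmod (iexp (h * x) - iexp (h * y)) = cmod (iexp (h * (x - y)) - 1)"
      by (simp only: norm_mult) simp
    also have "\<dots> \<le> \<bar>h * (x - y)\<bar>" using iexp_approx1[of "h * (x - y)" 0] by simp
    also have "\<dots> \<le> \<bar>h\<bar> * \<epsilon>" using False by (auto simp: abs_mult intro!: mult_left_mono)
    finally show ?thesis using False by simp
  qed
  fix e :: real assume e: "0 < e"
  \<comment> \<open>The two contributions, |h| \<epsilon> and less than 2 \<epsilon>, then stay
    below \<open>e\<close>.\<close>
  define \<epsilon> where "\<epsilon> = e / (\<bar>h\<bar> + 2)"
  have \<epsilon>: "0 < \<epsilon>" using e by (simp add: \<epsilon>_def add_nonneg_pos)
  show "eventually (\<lambda>k. dist (char (distr M borel (X k)) h) (char (distr M borel Y) h) < e) sequentially"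
    using lim[OF \<epsilon>]
  proof eventually_elim
    case (elim k)
    let ?A = "{\<omega> \<in> space M. \<epsilon> < \<bar>X k \<omega> - Y \<omega>\<bar>}"
    have int: "integrable M (\<lambda>\<omega>. iexp (h * X k \<omega>))" "integrable M (\<lambda>\<omega>. iexp (h * Y \<omega>))"
      by (auto intro!: integrable_const_bound[where B = 1])
    have "dist (char (distr M borel (X k)) h) (char (distr M borel Y) h)
        = cmod (CLINT \<omega>|M. iexp (h * X k \<omega>) - iexp (h * Y \<omega>))"
      using int by (simp add: char_def integral_distr dist_norm)
    also have "\<dots> \<le> (\<integral>\<omega>. \<bar>h\<bar> * \<epsilon> + 2 * indicator ?A \<omega> \<partial>M)"
    proof (rule order_trans[OF integral_norm_bound integral_mono])
      show "cmod (iexp (h * X k \<omega>) - iexp (h * Y \<omega>)) \<le> \<bar>h\<bar> * \<epsilon> + 2 * indicator ?A \<omega>"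
        if "\<omega> \<in> space M" for \<omega>
        using lip[of \<epsilon> "X k \<omega>" "Y \<omega>"] \<epsilon> that by (simp add: indicator_def)
    qed (use int in \<open>auto simp: emeasure_eq_measure\<close>)
    also have "\<dots> = \<bar>h\<bar> * \<epsilon> + 2 * prob ?A"
      by (subst Bochner_Integration.integral_add) (auto simp: prob_space emeasure_eq_measure)
    also have "\<dots> < (\<bar>h\<bar> + 2) * \<epsilon>" using elim by (simp add: algebra_simps)
    also have "\<dots> = e" by (simp add: \<epsilon>_def add_nonneg_pos less_imp_neq[symmetric])
    finally show ?case .
  qed
qed

text \<open>Markov's inequality for the truncated square of \<open>X\<close>, at the level
  \<open>min 1 (\<epsilon>\<^sup>2)\<close> that it reaches as soon as |X| exceeds
  \<epsilon>.\<close>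

lemma stable_law_tail:
  fixes X :: "'a \<Rightarrow> real"
  assumes [measurable]: "X \<in> borel_measurable M" and law: "stable_law \<alpha> c (distr M borel X)"
    and \<alpha>: "0 < \<alpha>" "\<alpha> < 2" and c: "0 \<le> c" and \<epsilon>: "0 < \<epsilon>"
  shows "prob {\<omega> \<in> space M. \<epsilon> < \<bar>X \<omega>\<bar>} \<le> 8 * c / min 1 (\<epsilon>\<^sup>2)"
proof -
  have "prob {\<omega> \<in> space M. \<epsilon> < \<bar>X \<omega>\<bar>} \<le> prob {\<omega> \<in> space M. min 1 (\<epsilon>\<^sup>2) \<le> min 1 ((X \<omega>)\<^sup>2)}"
    using \<epsilon> by (intro finite_measure_mono) (auto simp: abs_le_square_iff[symmetric] intro!: min.coboundedI2)
  also have "\<dots> \<le> expectation (\<lambda>\<omega>. min 1 ((X \<omega>)\<^sup>2)) / min 1 (\<epsilon>\<^sup>2)"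
    using \<epsilon> by (intro integral_Markov_inequality_measure[where A = "{}"]
        integrable_const_bound[where B = 1]) auto
  also have "expectation (\<lambda>\<omega>. min 1 ((X \<omega>)\<^sup>2)) = (\<integral>x. min 1 (x\<^sup>2) \<partial>distr M borel X)"
    by (simp add: integral_distr)
  also have "\<dots> / min 1 (\<epsilon>\<^sup>2) \<le> 8 * c / min 1 (\<epsilon>\<^sup>2)"
    using \<epsilon> by (intro divide_right_mono stable_law_truncated_second_moment[OF law \<alpha> c]) auto
  finally show ?thesis .
qed

end

section \<open>Stochastic integrals\<close>

lemma has_stochastic_integral_riemann_sum:
  "has_stochastic_integral M f Z t I \<longleftrightarrow> I \<in> borel_measurable M \<and>
     (\<forall>\<epsilon>>0. \<exists>\<delta>>0. \<forall>N p. fine_partition t \<delta> N p \<longrightarrow>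
        measure M {\<omega> \<in> space M. \<epsilon> < \<bar>riemann_sum f N p (\<lambda>s. Z s \<omega>) - I \<omega>\<bar>} < \<epsilon>)"
  by (simp add: has_stochastic_integral_def fine_partition_def riemann_sum_def)

lemma has_stochastic_integralD:
  assumes "has_stochastic_integral M f Z t I" "0 < \<epsilon>"
  obtains \<delta> where "0 < \<delta>" "\<And>N p. fine_partition t \<delta> N p \<Longrightarrow>
    measure M {\<omega> \<in> space M. \<epsilon> < \<bar>riemann_sum f N p (\<lambda>s. Z s \<omega>) - I \<omega>\<bar>} < \<epsilon>"
  using assms unfolding has_stochastic_integral_riemann_sum by blast

text \<open>There are \<open>Suc n\<close> cells, so that index 0 also gives a partition of
  [0, t].\<close>

definition uniform_partition :: "real \<Rightarrow> nat \<Rightarrow> nat \<Rightarrow> real" where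
  "uniform_partition t n k = real k * (t / real (Suc n))"

lemma uniform_partition_step:
  "uniform_partition t n (Suc k) - uniform_partition t n k = t / real (Suc n)"
  unfolding uniform_partition_def left_diff_distrib[symmetric] by simp

lemma fine_uniform_partition:
  assumes "0 \<le> t" "t / real (Suc n) < \<delta>"
  shows "fine_partition t \<delta> (Suc n) (uniform_partition t n)"
  unfolding fine_partition_def uniform_partition_step
proof (intro conjI allI impI)
  show "uniform_partition t n k \<le> uniform_partition t n (Suc k)" for k
    using uniform_partition_step[of t n k] divide_nonneg_nonneg[OF assms(1), of "real (Suc n)"]
    by linarith
qed (use assms in \<open>auto simp: uniform_partition_def\<close>)

text \<open>The mesh bound \<open>t + 1\<close> is deliberately crude: it makes the measurability
  and law of Riemann sums available for every \<open>n\<close>, however coarse the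
  partition.\<close>

lemma fine_uniform_partition_Suc:
  assumes "0 \<le> t"
  shows "fine_partition t (t + 1) (Suc n) (uniform_partition t n)"
proof (rule fine_uniform_partition[OF assms])
  have "t / real (Suc n) \<le> t / 1" using assms by (intro divide_left_mono) auto
  then show "t / real (Suc n) < t + 1" by simp
qed

lemma eventually_fine_uniform_partition:
  assumes "0 \<le> t" "0 < \<delta>"
  shows "eventually (\<lambda>n. fine_partition t \<delta> (Suc n) (uniform_partition t n)) sequentially"
proof -
  have "(\<lambda>n. t * inverse (real (Suc n))) \<longlonglongrightarrow> t * 0"
    by (intro tendsto_mult LIMSEQ_inverse_real_of_nat tendsto_const)
  then have "eventually (\<lambda>n. t * inverse (real (Suc n)) < \<delta>) sequentially"
    using assms by (auto dest: order_tendstoD(2))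
  then show ?thesis
    by eventually_elim (rule fine_uniform_partition[OF assms(1)], simp add: divide_inverse)
qed

context symmetric_stable_process
begin

lemma measurable_riemann_sum:
  assumes "fine_partition t \<delta> N p"
  shows "(\<lambda>\<omega>. riemann_sum f N p (\<lambda>s. Z s \<omega>)) \<in> borel_measurable M"
  unfolding riemann_sum_def using fine_partition_range[OF assms]
  by (auto intro!: borel_measurable_sum borel_measurable_times borel_measurable_diff measurable_Z)

lemma stable_law_riemann_sum:
  assumes "fine_partition t \<delta> N p"
  shows "stable_law \<alpha> (\<Sum>k<N. \<bar>f (p k)\<bar> powr \<alpha> * (p (Suc k) - p k))
    (distr M borel (\<lambda>\<omega>. riemann_sum f N p (\<lambda>s. Z s \<omega>)))"
  unfolding riemann_sum_def
  using assms by (intro stable_law_increments) (auto simp: fine_partition_def)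

text \<open>On a common refinement the two step functions differ by at most 2 \<eta>, by uniform
  continuity. The difference of the sums is then stable with coefficient at most (2 \<eta>)^\<alpha>
  t, and the tail bound turns a small coefficient into a small probability.\<close>

lemma riemann_sums_Cauchy:
  assumes \<alpha>: "0 < \<alpha>" "\<alpha> < 2" and f: "continuous_on {0..t} f" and t: "0 \<le> t" and \<epsilon>: "0 < \<epsilon>"
  obtains \<delta> where "0 < \<delta>" "\<And>N p N' q. fine_partition t \<delta> N p \<Longrightarrow> fine_partition t \<delta> N' q \<Longrightarrow>
    prob {\<omega> \<in> space M. \<epsilon> < \<bar>riemann_sum f N p (\<lambda>s. Z s \<omega>) - riemann_sum f N' q (\<lambda>s. Z s \<omega>)\<bar>} < \<epsilon>"
proof -
  \<comment> \<open>With coefficient at most C t the tail bound 8 C t / min 1 (\<epsilon>^2) equals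
    \<epsilon> t / (t + 1), strictly below \<epsilon> even for t = 0. \<open>\<eta>\<close> solves
    (2 \<eta>)^\<alpha> = C.\<close>
  define C where "C = \<epsilon> * min 1 (\<epsilon>\<^sup>2) / (8 * (t + 1))"
  define \<eta> where "\<eta> = C powr (1 / \<alpha>) / 2"
  have C: "0 < C" using \<epsilon> t by (simp add: C_def)
  have \<eta>: "0 < \<eta>" using C by (simp add: \<eta>_def)
  have C_eq: "(2 * \<eta>) powr \<alpha> = C" using C \<alpha> by (simp add: \<eta>_def powr_powr)
  have "uniformly_continuous_on {0..t} f"
    using f by (intro compact_uniformly_continuous) auto
  then obtain \<delta> where \<delta>: "0 < \<delta>" and
    near: "\<And>u s. u \<in> {0..t} \<Longrightarrow> s \<in> {0..t} \<Longrightarrow> dist u s < \<delta> \<Longrightarrow> dist (f u) (f s) < \<eta>"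
    using \<eta> unfolding uniformly_continuous_on_def by metis
  show thesis
  proof (rule that[OF \<delta>])
    fix N p N' q
    assume p: "fine_partition t \<delta> N p" and q: "fine_partition t \<delta> N' q"
    obtain n :: nat and r :: "nat \<Rightarrow> real" where r: "strict_mono_on {..n} r" "r 0 = 0" "r n = t"
      and sub: "p ` {..N} \<subseteq> r ` {..n}" "q ` {..N'} \<subseteq> r ` {..n}"
      by (rule common_refinement[OF p q])
    define a where "a i = step_fun f N p (r i) - step_fun f N' q (r i)" for i
    let ?X = "\<lambda>\<omega>. \<Sum>i<n. a i * (Z (r (Suc i)) \<omega> - Z (r i) \<omega>)"
    let ?c = "\<Sum>i<n. \<bar>a i\<bar> powr \<alpha> * (r (Suc i) - r i)"
    have eq: "riemann_sum f N p (\<lambda>s. Z s \<omega>) - riemann_sum f N' q (\<lambda>s. Z s \<omega>) = ?X \<omega>" for \<omega>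
      by (simp add: riemann_sum_refine[OF sub(1) r(1)] riemann_sum_refine[OF sub(2) r(1)]
          a_def sum_subtractf left_diff_distrib)
    have mono: "r i \<le> r (Suc i)" if "i < n" for i
      using that strict_mono_onD[OF r(1), of i "Suc i"] by simp
    have law: "stable_law \<alpha> ?c (distr M borel ?X)"
      using r mono by (intro stable_law_increments) auto
    have "?X \<in> borel_measurable (F (r n))"
      using r mono by (intro measurable_increments(1)) auto
    then have X: "?X \<in> borel_measurable M"
      unfolding r(3) by (rule measurable_from_subalg[OF subalgebra_F[OF t]])
    have abs_a: "\<bar>a i\<bar> \<le> 2 * \<eta>" if i: "i < n" for i
    proof -
      have ri: "0 \<le> r i" "r i < t"
        using i r strict_mono_onD[OF r(1), of i n] strict_mono_on_leD[OF r(1), of 0 i] by auto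
      have f_near: "\<bar>f u - f (r i)\<bar> \<le> \<eta>" if "0 \<le> u" "u \<le> r i" "r i - u < \<delta>" for u
        using near[of u "r i"] that ri by (auto simp: dist_real_def)
      have "\<bar>step_fun f N p (r i) - f (r i)\<bar> \<le> \<eta>" "\<bar>step_fun f N' q (r i) - f (r i)\<bar> \<le> \<eta>"
        using p q ri \<eta> f_near by (auto intro!: step_fun_approx)
      then show ?thesis by (simp add: a_def)
    qed
    have c0: "0 \<le> ?c" using mono by (intro sum_nonneg mult_nonneg_nonneg) auto
    have "?c \<le> (\<Sum>i<n. C * (r (Suc i) - r i))"
    proof (intro sum_mono mult_right_mono)
      fix i assume "i \<in> {..<n}"
      then have "\<bar>a i\<bar> powr \<alpha> \<le> (2 * \<eta>) powr \<alpha>"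
        using abs_a \<alpha> by (intro powr_mono2) auto
      then show "\<bar>a i\<bar> powr \<alpha> \<le> C" by (simp add: C_eq)
    qed (use mono in auto)
    also have "\<dots> = C * t"
      by (simp add: sum_distrib_left[symmetric] sum_lessThan_telescope r)
    finally have c_le: "?c \<le> C * t" .
    have cancel: "8 * (\<epsilon> * m / (8 * u) * t) / m = \<epsilon> * (t / u)" if "0 < m" "0 < u" for m u :: real
      using that by (simp add: field_simps)
    have "prob {\<omega> \<in> space M. \<epsilon> < \<bar>?X \<omega>\<bar>} \<le> 8 * ?c / min 1 (\<epsilon>\<^sup>2)"
      by (rule stable_law_tail[OF X law \<alpha> c0 \<epsilon>])
    also have "\<dots> \<le> 8 * (C * t) / min 1 (\<epsilon>\<^sup>2)"
      using c_le \<epsilon> by (intro divide_right_mono mult_left_mono) auto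
    also have "\<dots> = \<epsilon> * (t / (t + 1))"
      using \<epsilon> t unfolding C_def by (intro cancel) auto
    also have "\<dots> < \<epsilon> * 1"
      using \<epsilon> t by (intro mult_strict_left_mono) auto
    finally show "prob {\<omega> \<in> space M. \<epsilon> < \<bar>riemann_sum f N p (\<lambda>s. Z s \<omega>)
        - riemann_sum f N' q (\<lambda>s. Z s \<omega>)\<bar>} < \<epsilon>"
      by (simp add: eq)
  qed
qed

text \<open>The functional \<open>G\<close> proves existence, so that the \<open>SOME\<close> in
  \<open>stochastic_integral\<close> picks a genuine integral, and it lets independence pass from
  processes to integrals. It is the limit of uniform Riemann sums along a fast subsequence.\<close>

lemma stochastic_integral_path_functional:
  assumes \<alpha>: "0 < \<alpha>" "\<alpha> < 2" and f: "continuous_on {0..t} f" and t: "0 \<le> t"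
  obtains G where "G \<in> borel_measurable (\<Pi>\<^sub>M s\<in>{0..}. borel)"
    "has_stochastic_integral M f Z t (\<lambda>\<omega>. G (\<lambda>s\<in>{0..}. Z s \<omega>))"
proof -
  define R where "R n \<omega> = riemann_sum f (Suc n) (uniform_partition t n) (\<lambda>s. Z s \<omega>)" for n \<omega>
  note part = fine_uniform_partition_Suc[OF t]
  have R [measurable]: "R n \<in> borel_measurable M" for n
    unfolding R_def by (rule measurable_riemann_sum[OF part])
  have "\<exists>m. \<forall>n\<ge>m. \<forall>n'\<ge>m. prob {\<omega> \<in> space M. \<epsilon> < \<bar>R n \<omega> - R n' \<omega>\<bar>} < \<epsilon>" if \<epsilon>: "0 < \<epsilon>" for \<epsilon>
  proof -
    obtain \<delta> where \<delta>: "0 < \<delta>" "\<And>N p N' q. fine_partition t \<delta> N p \<Longrightarrow> fine_partition t \<delta> N' q \<Longrightarrow>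
      prob {\<omega> \<in> space M. \<epsilon> < \<bar>riemann_sum f N p (\<lambda>s. Z s \<omega>) - riemann_sum f N' q (\<lambda>s. Z s \<omega>)\<bar>} < \<epsilon>"
      by (rule riemann_sums_Cauchy[OF \<alpha> f t \<epsilon>]) blast
    obtain m where m: "\<And>n. m \<le> n \<Longrightarrow> fine_partition t \<delta> (Suc n) (uniform_partition t n)"
      using eventually_fine_uniform_partition[OF t \<delta>(1)] unfolding eventually_sequentially by blast
    show ?thesis unfolding R_def by (intro exI[of _ m] allI impI \<delta>(2) m)
  qed
  then have "\<forall>k. \<exists>m. \<forall>n\<ge>m. \<forall>n'\<ge>m. prob {\<omega> \<in> space M. (1/2)^k < \<bar>R n \<omega> - R n' \<omega>\<bar>} < (1/2)^k"
    by simp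
  then obtain m where m: "\<And>k n n'. m k \<le> n \<Longrightarrow> m k \<le> n' \<Longrightarrow>
      prob {\<omega> \<in> space M. (1/2)^k < \<bar>R n \<omega> - R n' \<omega>\<bar>} < (1/2)^k"
    by metis
  \<comment> \<open>Both \<open>g k\<close> and \<open>g (Suc k)\<close> are at least
    \<open>m k\<close>, which controls consecutive differences; the summand \<open>k\<close> drives
    \<open>g\<close> to infinity.\<close>
  define g where "g k = k + (\<Sum>j\<le>k. m j)" for k
  have g: "m k \<le> g k" "g k \<le> g (Suc k)" "k \<le> g k" for k
    using member_le_sum[of k "{..k}" m] by (auto simp: g_def)
  \<comment> \<open>Where the sums diverge, \<open>lim\<close> returns one fixed value, so
    \<open>G\<close> is total and measurable; almost no sample path is affected.\<close>
  define G where "G z = lim (\<lambda>k. riemann_sum f (Suc (g k)) (uniform_partition t (g k)) z)" for z :: "real \<Rightarrow> real"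
  define I where "I \<omega> = lim (\<lambda>k. R (g k) \<omega>)" for \<omega>
  have I [measurable]: "I \<in> borel_measurable M" unfolding I_def by measurable
  \<comment> \<open>All nodes lie in \<open>{0..}\<close>, so restricting a path to that set leaves
    its Riemann sums unchanged.\<close>
  have nonneg: "0 \<le> uniform_partition t n k" for n k
    using t by (simp add: uniform_partition_def)
  have "G \<in> borel_measurable (\<Pi>\<^sub>M s\<in>{0..}. borel)"
    unfolding G_def riemann_sum_def
    by (intro borel_measurable_lim_metric borel_measurable_sum borel_measurable_times
        borel_measurable_diff borel_measurable_const measurable_component_singleton)
      (auto simp: nonneg)
  moreover have "G (\<lambda>s\<in>{0..}. Z s \<omega>) = I \<omega>" for \<omega>
    by (simp add: G_def I_def R_def riemann_sum_def nonneg)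
  moreover have "has_stochastic_integral M f Z t I"
    unfolding has_stochastic_integral_riemann_sum
  proof (intro conjI allI impI)
    fix \<epsilon> :: real assume \<epsilon>: "0 < \<epsilon>"
    then have \<epsilon>2: "0 < \<epsilon> / 2" by simp
    obtain \<delta> where \<delta>: "0 < \<delta>" "\<And>N p N' q. fine_partition t \<delta> N p \<Longrightarrow> fine_partition t \<delta> N' q \<Longrightarrow>
      prob {\<omega> \<in> space M. \<epsilon>/2 < \<bar>riemann_sum f N p (\<lambda>s. Z s \<omega>) - riemann_sum f N' q (\<lambda>s. Z s \<omega>)\<bar>} < \<epsilon>/2"
      by (rule riemann_sums_Cauchy[OF \<alpha> f t \<epsilon>2]) blast
    have "AE \<omega> in M. convergent (\<lambda>k. R (g k) \<omega>)"
      using m[OF g(1) order_trans[OF g(1) g(2)]]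
      by (intro AE_convergent_if_prob_increments)
        (auto simp: abs_minus_commute intro!: less_imp_le)
    then have "AE \<omega> in M. (\<lambda>k. R (g k) \<omega>) \<longlonglongrightarrow> I \<omega>"
      by eventually_elim (simp add: I_def convergent_LIMSEQ_iff)
    then have "(\<lambda>k. prob {\<omega> \<in> space M. \<epsilon>/2 < \<bar>R (g k) \<omega> - I \<omega>\<bar>}) \<longlonglongrightarrow> 0"
      using \<epsilon> by (intro AE_tendsto_imp_tendsto_prob) auto
    then have "eventually (\<lambda>k. prob {\<omega> \<in> space M. \<epsilon>/2 < \<bar>R (g k) \<omega> - I \<omega>\<bar>} < \<epsilon>/2) sequentially"
      using \<epsilon>2 by (rule order_tendstoD(2))
    moreover have "filterlim g at_top sequentially"
      using g(3) by (intro filterlim_at_top_mono[OF filterlim_ident]) auto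
    then have "eventually (\<lambda>k. fine_partition t \<delta> (Suc (g k)) (uniform_partition t (g k))) sequentially"
      using eventually_fine_uniform_partition[OF t \<delta>(1)] by (rule eventually_compose_filterlim[rotated])
    ultimately have "eventually (\<lambda>k. prob {\<omega> \<in> space M. \<epsilon>/2 < \<bar>R (g k) \<omega> - I \<omega>\<bar>} < \<epsilon>/2 \<and>
        fine_partition t \<delta> (Suc (g k)) (uniform_partition t (g k))) sequentially"
      by (rule eventually_conj)
    then obtain k where k: "prob {\<omega> \<in> space M. \<epsilon>/2 < \<bar>R (g k) \<omega> - I \<omega>\<bar>} < \<epsilon>/2"
      "fine_partition t \<delta> (Suc (g k)) (uniform_partition t (g k))"
      using eventually_happens trivial_limit_sequentially by blast
    \<comment> \<open>Any fine partition is compared with a single uniform one that is itself fine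
      and whose sum is close to \<open>I\<close> in probability.\<close>
    have "prob {\<omega> \<in> space M. \<epsilon> < \<bar>riemann_sum f N p (\<lambda>s. Z s \<omega>) - I \<omega>\<bar>} < \<epsilon>"
      if p: "fine_partition t \<delta> N p" for N p
    proof -
      have "prob {\<omega> \<in> space M. \<epsilon>/2 + \<epsilon>/2 < \<bar>riemann_sum f N p (\<lambda>s. Z s \<omega>) - I \<omega>\<bar>}
        \<le> prob {\<omega> \<in> space M. \<epsilon>/2 < \<bar>riemann_sum f N p (\<lambda>s. Z s \<omega>) - R (g k) \<omega>\<bar>}
          + prob {\<omega> \<in> space M. \<epsilon>/2 < \<bar>R (g k) \<omega> - I \<omega>\<bar>}"
        by (intro prob_triangle measurable_riemann_sum[OF p] R I)
      also have "\<dots> < \<epsilon>/2 + \<epsilon>/2"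
        using \<delta>(2)[OF p k(2)] k(1) unfolding R_def by (intro add_strict_mono)
      finally show ?thesis by simp
    qed
    then show "\<exists>\<delta>>0. \<forall>N p. fine_partition t \<delta> N p \<longrightarrow>
        prob {\<omega> \<in> space M. \<epsilon> < \<bar>riemann_sum f N p (\<lambda>s. Z s \<omega>) - I \<omega>\<bar>} < \<epsilon>"
      using \<delta>(1) by blast
  qed (rule I)
  ultimately show thesis by (intro that) auto
qed

text \<open>A uniform partition fine enough for both has a Riemann sum close to both. This
  identifies the version chosen by \<open>SOME\<close> with the path functional.\<close>

lemma has_stochastic_integral_unique:
  assumes I: "has_stochastic_integral M f Z t I" and J: "has_stochastic_integral M f Z t J" and t: "0 \<le> t"
  shows "AE \<omega> in M. I \<omega> = J \<omega>"
proof (rule AE_eq_if_prob_small)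
  show [measurable]: "I \<in> borel_measurable M" "J \<in> borel_measurable M"
    using I J by (auto simp: has_stochastic_integral_riemann_sum)
  fix \<epsilon> :: real assume "0 < \<epsilon>"
  then have \<epsilon>: "0 < \<epsilon> / 2" by simp
  obtain \<delta> where \<delta>: "0 < \<delta>" "\<And>N p. fine_partition t \<delta> N p \<Longrightarrow>
      prob {\<omega> \<in> space M. \<epsilon>/2 < \<bar>riemann_sum f N p (\<lambda>s. Z s \<omega>) - I \<omega>\<bar>} < \<epsilon>/2"
    by (rule has_stochastic_integralD[OF I \<epsilon>]) blast
  obtain \<delta>' where \<delta>': "0 < \<delta>'" "\<And>N p. fine_partition t \<delta>' N p \<Longrightarrow>
      prob {\<omega> \<in> space M. \<epsilon>/2 < \<bar>riemann_sum f N p (\<lambda>s. Z s \<omega>) - J \<omega>\<bar>} < \<epsilon>/2"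
    by (rule has_stochastic_integralD[OF J \<epsilon>]) blast
  have "eventually (\<lambda>n. fine_partition t \<delta> (Suc n) (uniform_partition t n) \<and>
      fine_partition t \<delta>' (Suc n) (uniform_partition t n)) sequentially"
    using t \<delta>(1) \<delta>'(1) by (intro eventually_conj eventually_fine_uniform_partition)
  then obtain n where n: "fine_partition t \<delta> (Suc n) (uniform_partition t n)"
      "fine_partition t \<delta>' (Suc n) (uniform_partition t n)"
    using eventually_happens trivial_limit_sequentially by blast
  let ?R = "\<lambda>\<omega>. riemann_sum f (Suc n) (uniform_partition t n) (\<lambda>s. Z s \<omega>)"
  have "prob {\<omega> \<in> space M. \<epsilon>/2 + \<epsilon>/2 < \<bar>I \<omega> - J \<omega>\<bar>}
    \<le> prob {\<omega> \<in> space M. \<epsilon>/2 < \<bar>I \<omega> - ?R \<omega>\<bar>} + prob {\<omega> \<in> space M. \<epsilon>/2 < \<bar>?R \<omega> - J \<omega>\<bar>}"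
    by (intro prob_triangle measurable_riemann_sum[OF n(1)]) auto
  also have "\<dots> \<le> \<epsilon>/2 + \<epsilon>/2"
    using \<delta>(2)[OF n(1)] \<delta>'(2)[OF n(2)] by (intro add_mono) (auto simp: abs_minus_commute)
  finally show "prob {\<omega> \<in> space M. \<epsilon> < \<bar>I \<omega> - J \<omega>\<bar>} \<le> \<epsilon>" by simp
qed

text \<open>Convergence in probability carries the characteristic functions to the limit, so
  \<open>c\<close> is the limit of the coefficients along uniform partitions; it stands for the
  integral of |f|^\<alpha> over [0, t].\<close>

lemma stable_law_stochastic_integral:
  assumes I: "has_stochastic_integral M f Z t I" and t: "0 \<le> t"
    and c: "(\<lambda>n. \<Sum>k<Suc n. \<bar>f (uniform_partition t n k)\<bar> powr \<alpha> * (t / real (Suc n))) \<longlonglongrightarrow> c"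
  shows "stable_law \<alpha> c (distr M borel I)"
proof -
  have [measurable]: "I \<in> borel_measurable M"
    using I by (simp add: has_stochastic_integral_riemann_sum)
  define R where "R n \<omega> = riemann_sum f (Suc n) (uniform_partition t n) (\<lambda>s. Z s \<omega>)" for n \<omega>
  note part = fine_uniform_partition_Suc[OF t]
  have R [measurable]: "R n \<in> borel_measurable M" for n
    unfolding R_def by (rule measurable_riemann_sum[OF part])
  have "eventually (\<lambda>n. prob {\<omega> \<in> space M. \<epsilon> < \<bar>R n \<omega> - I \<omega>\<bar>} < \<epsilon>) sequentially" if \<epsilon>: "0 < \<epsilon>" for \<epsilon>
  proof -
    obtain \<delta> where \<delta>: "0 < \<delta>" "\<And>N p. fine_partition t \<delta> N p \<Longrightarrow>
        prob {\<omega> \<in> space M. \<epsilon> < \<bar>riemann_sum f N p (\<lambda>s. Z s \<omega>) - I \<omega>\<bar>} < \<epsilon>"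
      by (rule has_stochastic_integralD[OF I \<epsilon>]) blast
    show ?thesis
      using eventually_fine_uniform_partition[OF t \<delta>(1)]
      by eventually_elim (simp add: R_def \<delta>(2))
  qed
  then have lim: "(\<lambda>n. char (distr M borel (R n)) h) \<longlonglongrightarrow> char (distr M borel I) h" for h
    by (intro tendsto_char_if_tendsto_prob) auto
  have "char (distr M borel (R n)) h = complex_of_real
      (exp (- (\<Sum>k<Suc n. \<bar>f (uniform_partition t n k)\<bar> powr \<alpha> * (t / real (Suc n))) * \<bar>h\<bar> powr \<alpha>))" for n h
  proof -
    show ?thesis
      using stable_law_riemann_sum[OF part, of f n]
      unfolding stable_law_def R_def uniform_partition_step by blast
  qed
  then have "(\<lambda>n. char (distr M borel (R n)) h) \<longlonglongrightarrow> complex_of_real (exp (- c * \<bar>h\<bar> powr \<alpha>))" for h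
    using c by (auto intro!: tendsto_intros simp del: sum.lessThan_Suc)
  then have "char (distr M borel I) h = complex_of_real (exp (- c * \<bar>h\<bar> powr \<alpha>))" for h
    using lim LIMSEQ_unique by blast
  then show ?thesis
    by (simp add: stable_law_def real_distribution_distr)
qed

end

text \<open>With d = t / (n + 1) the sum is geometric of ratio e^(a d) and equals (1 - e^(-a t)) /
  ((e^(a d) - 1) / d). The denominator is a difference quotient of e^(a x) at 0 and tends to
  a.\<close>

lemma tendsto_geometric_riemann_sum:
  fixes a t :: real
  assumes a: "0 < a" and t: "0 < t"
  shows "(\<lambda>n. \<Sum>k<Suc n. exp (- a * (t - uniform_partition t n k)) * (t / real (Suc n)))
    \<longlonglongrightarrow> (1 - exp (- a * t)) / a"
proof -
  define d where "d n = t / real (Suc n)" for n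
  have d: "0 < d n" for n using t by (simp add: d_def)
  have "d \<longlonglongrightarrow> 0"
    using tendsto_mult[OF tendsto_const[of t] LIMSEQ_inverse_real_of_nat]
    by (simp add: d_def[abs_def] divide_inverse)
  then have "filterlim d (at 0) sequentially"
    unfolding filterlim_at using d by (auto simp: less_imp_neq[symmetric])
  moreover have "((\<lambda>x. exp (a * x)) has_field_derivative a) (at 0)"
    by (auto intro!: derivative_eq_intros)
  then have "((\<lambda>h. (exp (a * h) - 1) / h) \<longlongrightarrow> a) (at 0)"
    by (simp add: DERIV_def)
  ultimately have "(\<lambda>n. (exp (a * d n) - 1) / d n) \<longlonglongrightarrow> a"
    by (rule filterlim_compose[rotated])
  then have lim: "(\<lambda>n. (1 - exp (- a * t)) / ((exp (a * d n) - 1) / d n)) \<longlonglongrightarrow> (1 - exp (- a * t)) / a"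
    using a by (intro tendsto_divide tendsto_const) auto
  have "(\<Sum>k<Suc n. exp (- a * (t - uniform_partition t n k)) * (t / real (Suc n)))
      = (1 - exp (- a * t)) / ((exp (a * d n) - 1) / d n)" for n
  proof -
    have "exp (- a * (t - uniform_partition t n k)) = exp (- a * t) * exp (a * d n) ^ k" for k
      by (simp add: uniform_partition_def d_def exp_of_nat_mult[symmetric] exp_add[symmetric] algebra_simps)
    then have "(\<Sum>k<Suc n. exp (- a * (t - uniform_partition t n k)) * (t / real (Suc n)))
        = exp (- a * t) * (\<Sum>k<Suc n. exp (a * d n) ^ k) * d n"
      by (simp only: sum_distrib_left sum_distrib_right d_def)
    also have "(\<Sum>k<Suc n. exp (a * d n) ^ k) = (exp (a * d n) ^ Suc n - 1) / (exp (a * d n) - 1)"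
      using a d[of n] by (intro geometric_sum) auto
    also have "exp (a * d n) ^ Suc n = exp (a * t)"
      unfolding exp_of_nat_mult[symmetric] by (simp add: d_def)
    also have "exp (- a * t) * ((exp (a * t) - 1) / (exp (a * d n) - 1)) * d n
        = (exp (- a * t) * exp (a * t) - exp (- a * t)) / ((exp (a * d n) - 1) / d n)"
      by (simp add: algebra_simps)
    also have "exp (- a * t) * exp (a * t) = 1"
      by (simp add: exp_add[symmetric])
    finally show ?thesis .
  qed
  then show ?thesis using lim by simp
qed

lemma tendsto_OU_riemann_sum:
  fixes \<gamma> \<beta> \<alpha> t :: real
  assumes pos: "0 < \<gamma>" "0 < \<beta>" "0 < \<alpha>" "0 < t"
  shows "(\<lambda>n. \<Sum>k<Suc n. \<bar>exp (- \<gamma> * (t - uniform_partition t n k)) * \<beta>\<bar> powr \<alpha> * (t / real (Suc n)))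
    \<longlonglongrightarrow> \<beta> powr \<alpha> * ((1 - exp (- (\<alpha> * \<gamma>) * t)) / (\<alpha> * \<gamma>))"
proof -
  have "\<bar>exp (- \<gamma> * u) * \<beta>\<bar> powr \<alpha> = \<beta> powr \<alpha> * exp (- (\<alpha> * \<gamma>) * u)" for u
    using pos by (simp add: abs_mult powr_mult exp_powr_real mult_ac)
  then have "(\<Sum>k<Suc n. \<bar>exp (- \<gamma> * (t - uniform_partition t n k)) * \<beta>\<bar> powr \<alpha> * (t / real (Suc n)))
      = \<beta> powr \<alpha> * (\<Sum>k<Suc n. exp (- (\<alpha> * \<gamma>) * (t - uniform_partition t n k)) * (t / real (Suc n)))" for n
    by (simp only: sum_distrib_left mult.assoc)
  then show ?thesis
    using tendsto_mult[OF tendsto_const tendsto_geometric_riemann_sum[of "\<alpha> * \<gamma>" t]] pos by simp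
qed

section \<open>Orthonormal series\<close>

lemma norm_sum_orthonormal:
  fixes e :: "nat \<Rightarrow> 'h::real_inner"
  assumes "\<And>i j. e i \<bullet> e j = (if i = j then 1 else 0)" "finite A"
  shows "(norm (\<Sum>n\<in>A. a n *\<^sub>R e n))\<^sup>2 = (\<Sum>n\<in>A. (a n)\<^sup>2)"
  unfolding power2_norm_eq_inner inner_sum_left inner_sum_right using assms
  by (simp add: power2_eq_square if_distrib[of "\<lambda>u. _ * u"] cong: if_cong)

lemma orthonormal_series:
  fixes e :: "nat \<Rightarrow> 'h::{real_inner, banach}"
  assumes e: "\<And>i j. e i \<bullet> e j = (if i = j then 1 else 0)" and a: "summable (\<lambda>n. (a n)\<^sup>2)"
  shows "summable (\<lambda>n. a n *\<^sub>R e n)" "(norm (\<Sum>n. a n *\<^sub>R e n))\<^sup>2 = (\<Sum>n. (a n)\<^sup>2)"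
proof -
  show *: "summable (\<lambda>n. a n *\<^sub>R e n)"
    unfolding summable_Cauchy
  proof (intro allI impI)
    fix \<epsilon> :: real assume \<epsilon>: "0 < \<epsilon>"
    then obtain N where N: "\<And>m n. N \<le> m \<Longrightarrow> norm (\<Sum>k=m..<n. (a k)\<^sup>2) < \<epsilon>\<^sup>2"
      using a unfolding summable_Cauchy by (meson zero_less_power)
    have "norm (\<Sum>k=m..<n. a k *\<^sub>R e k) < \<epsilon>" if "N \<le> m" for m n
    proof (rule power_less_imp_less_base[where n = 2])
      show "(norm (\<Sum>k=m..<n. a k *\<^sub>R e k))\<^sup>2 < \<epsilon>\<^sup>2"
        using N[OF that, of n] by (simp add: norm_sum_orthonormal[OF e] sum_nonneg)
    qed (use \<epsilon> in simp)
    then show "\<exists>N. \<forall>m\<ge>N. \<forall>n. norm (\<Sum>k=m..<n. a k *\<^sub>R e k) < \<epsilon>" by blast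
  qed
  have "(\<lambda>n. (norm (\<Sum>k<n. a k *\<^sub>R e k))\<^sup>2) \<longlonglongrightarrow> (norm (\<Sum>n. a n *\<^sub>R e n))\<^sup>2"
    by (intro tendsto_intros summable_LIMSEQ *)
  moreover have "(\<lambda>n. (norm (\<Sum>k<n. a k *\<^sub>R e k))\<^sup>2) \<longlonglongrightarrow> (\<Sum>n. (a n)\<^sup>2)"
    using summable_LIMSEQ[OF a] by (simp add: norm_sum_orthonormal[OF e])
  ultimately show "(norm (\<Sum>n. a n *\<^sub>R e n))\<^sup>2 = (\<Sum>n. (a n)\<^sup>2)"
    by (rule LIMSEQ_unique)
qed

lemma summable_inner_orthonormal:
  fixes e :: "nat \<Rightarrow> 'h::real_inner"
  assumes e: "\<And>i j. e i \<bullet> e j = (if i = j then 1 else 0)"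
  shows "summable (\<lambda>n. (x \<bullet> e n)\<^sup>2)"
proof (rule summableI_nonneg_bounded)
  fix n
  define s where "s = (\<Sum>k<n. (x \<bullet> e k) *\<^sub>R e k)"
  have "x \<bullet> s = (\<Sum>k<n. (x \<bullet> e k)\<^sup>2)"
    by (simp add: s_def inner_sum_right power2_eq_square)
  moreover have "(norm s)\<^sup>2 = (\<Sum>k<n. (x \<bullet> e k)\<^sup>2)"
    by (simp add: s_def norm_sum_orthonormal[OF e])
  moreover have "(norm (x - s))\<^sup>2 = (norm x)\<^sup>2 - 2 * (x \<bullet> s) + (norm s)\<^sup>2"
    by (simp add: power2_norm_eq_inner inner_diff_left inner_diff_right inner_commute)
  ultimately show "(\<Sum>k<n. (x \<bullet> e k)\<^sup>2) \<le> (norm x)\<^sup>2"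
    using zero_le_power2[of "norm (x - s)"] by linarith
qed simp

text \<open>The difference between \<open>x\<close> and the sum of its Fourier series is orthogonal
  to every \<open>e k\<close>, hence to the closure of their span, which is everything, hence to
  itself.\<close>

lemma orthonormal_basis_expansion:
  fixes e :: "nat \<Rightarrow> 'h::{real_inner, banach}"
  assumes "orthonormal_basis e"
  shows "(\<lambda>n. (x \<bullet> e n) *\<^sub>R e n) sums x"
proof -
  have e: "e i \<bullet> e j = (if i = j then 1 else 0)" for i j
    using assms by (simp add: orthonormal_basis_def)
  define s where "s = (\<Sum>n. (x \<bullet> e n) *\<^sub>R e n)"
  have sums: "(\<lambda>n. (x \<bullet> e n) *\<^sub>R e n) sums s"
    unfolding s_def using summable_inner_orthonormal[of e x] e
    by (intro summable_sums orthonormal_series) auto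
  have "s \<bullet> e k = x \<bullet> e k" for k
  proof -
    have "(\<lambda>n. ((x \<bullet> e n) *\<^sub>R e n) \<bullet> e k) sums (s \<bullet> e k)"
      using sums by (rule bounded_linear.sums[OF bounded_linear_inner_left])
    moreover have "(\<lambda>n. ((x \<bullet> e n) *\<^sub>R e n) \<bullet> e k) = (\<lambda>n. if n = k then x \<bullet> e n else 0)"
      by (auto simp: e)
    ultimately show ?thesis
      using sums_single[of k "\<lambda>n. x \<bullet> e n"] sums_unique2 by metis
  qed
  then have "range e \<subseteq> {y. (x - s) \<bullet> y = 0}" by (auto simp: inner_diff_left)
  then have "span (range e) \<subseteq> {y. (x - s) \<bullet> y = 0}"
    by (intro span_minimal) (auto simp: subspace_def inner_right_distrib)
  moreover have "closed {y. (x - s) \<bullet> y = 0}"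
    by (intro closed_Collect_eq continuous_intros)
  ultimately have "closure (span (range e)) \<subseteq> {y. (x - s) \<bullet> y = 0}"
    by (rule closure_minimal)
  then have "(x - s) \<bullet> (x - s) = 0" using assms unfolding orthonormal_basis_def by blast
  then show ?thesis using sums by simp
qed

lemma power2_diff_le: "(u - v)\<^sup>2 \<le> 2 * u\<^sup>2 + 2 * (v\<^sup>2 :: real)"
  using zero_le_power2[of "u + v"] by (simp add: power2_eq_square algebra_simps)

lemma summable_power2_diff:
  fixes u v :: "nat \<Rightarrow> real"
  assumes "summable (\<lambda>n. (u n)\<^sup>2)" "summable (\<lambda>n. (v n)\<^sup>2)"
  shows "summable (\<lambda>n. (u n - v n)\<^sup>2)"
proof (rule summable_comparison_test)
  show "\<exists>N. \<forall>n\<ge>N. norm ((u n - v n)\<^sup>2) \<le> 2 * (u n)\<^sup>2 + 2 * (v n)\<^sup>2"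
    by (simp add: power2_diff_le)
  show "summable (\<lambda>n. 2 * (u n)\<^sup>2 + 2 * (v n)\<^sup>2)"
    by (intro summable_add summable_mult assms)
qed

text \<open>The deterministic part of the argument, for one sample point: \<open>j\<close> are the
  noise coordinates, \<open>m\<close> their targets. The tail of (j - m)^2 is below 2 \<rho> + 2
  \<rho>, the head at most N \<epsilon>^2; convergence belongs to the conclusion.\<close>

lemma orthonormal_series_close:
  fixes e :: "nat \<Rightarrow> 'h::{real_inner, banach}"
  assumes e: "\<And>i j. e i \<bullet> e j = (if i = j then 1 else 0)"
    and m: "summable (\<lambda>n. (m n)\<^sup>2)" "(\<Sum>n. (m (n + N))\<^sup>2) < \<rho>"
    and \<rho>: "0 < \<rho>" "\<rho> \<le> 1" and j: "(\<Sum>n. ennreal (min 1 ((j (n + N))\<^sup>2))) < ennreal \<rho>"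
    and head: "\<And>i. i < N \<Longrightarrow> \<bar>j i - m i\<bar> < \<epsilon>" and r: "0 < r" "real N * \<epsilon>\<^sup>2 + 4 * \<rho> \<le> r\<^sup>2"
  shows "\<exists>s. (\<lambda>n. (j n - m n) *\<^sub>R e n) sums s \<and> norm s < r"
proof -
  define w where "w n = min 1 ((j (n + N))\<^sup>2)" for n
  have w0: "0 \<le> w n" for n by (simp add: w_def)
  have "(\<Sum>n. ennreal (w n)) \<noteq> top" using j unfolding w_def[symmetric] by auto
  then have w: "summable w" using w0 by (intro summable_suminf_not_top)
  then have "(\<Sum>n. ennreal (w n)) = ennreal (suminf w)"
    using w0 by (intro suminf_ennreal2) auto
  then have w_less: "suminf w < \<rho>" using j \<rho> 
    unfolding w_def[symmetric] by (simp add: ennreal_less_iff suminf_nonneg w w0)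
  \<comment> \<open>A total below \<open>\<rho> \<le> 1\<close> keeps every single term under the
    truncation level, so \<open>w\<close> is the plain square.\<close>
  have w1: "w n < 1" for n
  proof -
    have "w n \<le> suminf w" using sum_le_suminf[OF w, of "{n}"] w0 by simp
    then show ?thesis using w_less \<rho> by simp
  qed
  have w_eq: "w = (\<lambda>n. (j (n + N))\<^sup>2)"
  proof
    show "w n = (j (n + N))\<^sup>2" for n
      using w1[of n] by (auto simp: w_def min_def split: if_splits)
  qed
  have j': "summable (\<lambda>n. (j (n + N))\<^sup>2)" "(\<Sum>n. (j (n + N))\<^sup>2) < \<rho>"
    using w w_less unfolding w_eq by blast+
  have m': "summable (\<lambda>n. (m (n + N))\<^sup>2)" 
    using m(1) summable_iff_shift[of "\<lambda>n. (m n)\<^sup>2" N] by blast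
  define a where "a n = j n - m n" for n
  have a_shift: "summable (\<lambda>n. (a (n + N))\<^sup>2)"
    unfolding a_def by (rule summable_power2_diff[OF j'(1) m'])
  then have a: "summable (\<lambda>n. (a n)\<^sup>2)"
    using summable_iff_shift[of "\<lambda>n. (a n)\<^sup>2" N] by blast
  have "(\<Sum>n. (a (n + N))\<^sup>2) \<le> (\<Sum>n. 2 * (j (n + N))\<^sup>2 + 2 * (m (n + N))\<^sup>2)"
    by (intro suminf_le summable_add summable_mult a_shift j'(1) m') (unfold a_def, rule power2_diff_le)
  then have tail: "(\<Sum>n. (a (n + N))\<^sup>2) < 4 * \<rho>"
    using suminf_add[OF summable_mult[OF j'(1), of 2] summable_mult[OF m', of 2]]
      suminf_mult[OF j'(1), of 2] suminf_mult[OF m', of 2] j'(2) m(2) by linarith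
  have "(\<Sum>i<N. (a i)\<^sup>2) \<le> (\<Sum>i<N. \<epsilon>\<^sup>2)"
  proof (rule sum_mono)
    fix i assume "i \<in> {..<N}"
    then have "\<bar>a i\<bar> \<le> \<bar>\<epsilon>\<bar>" using head[of i] by (simp add: a_def)
    then show "(a i)\<^sup>2 \<le> \<epsilon>\<^sup>2" by (simp only: abs_le_square_iff)
  qed
  then have "(\<Sum>n. (a n)\<^sup>2) < r\<^sup>2"
    using tail r suminf_split_initial_segment[OF a, of N] by simp
  then have "(norm (\<Sum>n. a n *\<^sub>R e n))\<^sup>2 < r\<^sup>2"
    using orthonormal_series(2)[of e a] e a by simp
  then have "norm (\<Sum>n. a n *\<^sub>R e n) < r" 
    by (rule power_less_imp_less_base) (use r in simp)
  moreover have "(\<lambda>n. a n *\<^sub>R e n) sums (\<Sum>n. a n *\<^sub>R e n)"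
    using orthonormal_series(1)[of e a] e a by (intro summable_sums) auto
  ultimately show ?thesis unfolding a_def by blast
qed

section \<open>Irreducibility\<close>

text \<open>Let p be the probability of the head event. Integrating its indicator times the
  truncated tail would give p \<rho> at most p times the sum of the 8 c (n + N), against the choice
  of \<rho>, because 0 < p < \<infinity>.\<close>

lemma (in prob_space) head_and_tail_not_AE:
  fixes J :: "nat \<Rightarrow> 'a \<Rightarrow> real"
  assumes indep: "indep_vars (\<lambda>_. borel) J UNIV" and \<alpha>: "0 < \<alpha>" "\<alpha> < 2"
    and law: "\<And>n. stable_law \<alpha> (c n) (distr M borel (J n))"
    and c: "\<And>n. 0 < c n" "summable c" "8 * (\<Sum>n. c (n + N)) < \<rho>" and \<epsilon>: "0 < \<epsilon>"
  shows "\<not> (AE \<omega> in M. (\<forall>i<N. \<bar>J i \<omega> - m i\<bar> < \<epsilon>) \<longrightarrow>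
    ennreal \<rho> \<le> (\<Sum>n. ennreal (min 1 ((J (n + N) \<omega>)\<^sup>2))))"
proof
  assume AE: "AE \<omega> in M. (\<forall>i<N. \<bar>J i \<omega> - m i\<bar> < \<epsilon>) \<longrightarrow>
    ennreal \<rho> \<le> (\<Sum>n. ennreal (min 1 ((J (n + N) \<omega>)\<^sup>2)))"
  have J [measurable]: "J n \<in> borel_measurable M" for n
    using indep by (simp add: indep_vars_def)
  define q where "q i \<omega> = (indicator (ball (m i) \<epsilon>) (J i \<omega>) :: ennreal)" for i \<omega>
  define T where "T i \<omega> = ennreal (min 1 ((J i \<omega>)\<^sup>2))" for i \<omega>
  define p where "p = (\<Prod>i<N. \<integral>\<^sup>+\<omega>. q i \<omega> \<partial>M)"
  have [measurable]: "q i \<in> borel_measurable M" for i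
    unfolding q_def[abs_def] by (rule measurable_compose[OF J borel_measurable_indicator]) simp
  have [measurable]: "T i \<in> borel_measurable M" for i
    unfolding T_def[abs_def] by measurable
  \<comment> \<open>One transformed family for head indicators and tail terms, so that its
    independence covers both kinds of factor.\<close>
  define Y where "Y i y = (if i < N then indicator (ball (m i) \<epsilon>) y else ennreal (min 1 (y\<^sup>2)))"
    for i and y :: real
  have "indep_vars (\<lambda>_. borel) (\<lambda>i \<omega>. Y i (J i \<omega>)) UNIV"
  proof (rule indep_vars_compose2[OF indep])
    show "Y i \<in> borel_measurable borel" for i
      unfolding Y_def[abs_def] by (cases "i < N") (simp_all add: borel_measurable_indicator)
  qed
  then have indep_Y: "indep_vars (\<lambda>_. borel) (\<lambda>i \<omega>. Y i (J i \<omega>)) I" for I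
    by (rule indep_vars_subset) simp
  have YJ: "Y i (J i \<omega>) = q i \<omega>" if "i < N" for i \<omega>
    using that by (simp add: Y_def q_def)
  have YJ': "Y (n + N) (J (n + N) \<omega>) = T (n + N) \<omega>" for n \<omega>
    by (simp add: Y_def T_def)
  have head: "(\<integral>\<^sup>+\<omega>. (\<Prod>i<N. q i \<omega>) \<partial>M) = p"
    using indep_vars_nn_integral[OF _ indep_Y, of "{..<N}"] by (simp add: p_def YJ)
  \<comment> \<open>Tail terms are taken one at a time: each forms a finite independent family with
    the N head factors.\<close>
  have joint: "(\<integral>\<^sup>+\<omega>. (\<Prod>i<N. q i \<omega>) * T (n + N) \<omega> \<partial>M) = p * (\<integral>\<^sup>+\<omega>. T (n + N) \<omega> \<partial>M)" for n
    using indep_vars_nn_integral[OF _ indep_Y, of "insert (n + N) {..<N}"]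
    by (simp add: p_def YJ YJ' mult.commute)
  have q_pos: "0 < (\<integral>\<^sup>+\<omega>. q i \<omega> \<partial>M)" for i
  proof -
    have "(\<integral>\<^sup>+\<omega>. q i \<omega> \<partial>M) = (\<integral>\<^sup>+y. indicator (ball (m i) \<epsilon>) y \<partial>distr M borel (J i))"
      unfolding q_def by (subst nn_integral_distr) (auto intro: borel_measurable_indicator)
    also have "\<dots> = emeasure (distr M borel (J i)) (ball (m i) \<epsilon>)" by simp
    also have "\<dots> > 0"
      using stable_law_full_support[OF law \<alpha> c(1) \<epsilon>, of i "m i"]
      by (metis measure_def enn2real_0 less_irrefl not_gr_zero)
    finally show ?thesis .
  qed
  have q_le: "(\<integral>\<^sup>+\<omega>. q i \<omega> \<partial>M) \<le> 1" for i
  proof -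
    have "(\<integral>\<^sup>+\<omega>. q i \<omega> \<partial>M) \<le> (\<integral>\<^sup>+\<omega>. 1 \<partial>M)"
      by (intro nn_integral_mono) (simp add: q_def indicator_def)
    then show ?thesis by (simp add: emeasure_space_1)
  qed
  have p_pos: "0 < p"
    unfolding p_def using q_pos by (simp add: zero_less_iff_neq_zero)
  have "(\<Prod>i<k. \<integral>\<^sup>+\<omega>. q i \<omega> \<partial>M) < top" for k
  proof (induction k)
    case (Suc k)
    have "(\<integral>\<^sup>+\<omega>. q k \<omega> \<partial>M) < top" using q_le[of k] by (simp add: le_less_trans)
    then show ?case using Suc.IH by (simp add: ennreal_mult_less_top)
  qed simp
  \<comment> \<open>Finiteness of \<open>p\<close> keeps the final inequality strict after
    multiplication in \<open>ennreal\<close>.\<close>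
  then have p_top: "p < top" by (simp add: p_def)
  have T_le: "(\<integral>\<^sup>+\<omega>. T i \<omega> \<partial>M) \<le> ennreal (8 * c i)" for i
  proof -
    have "(\<integral>\<^sup>+\<omega>. T i \<omega> \<partial>M) = ennreal (\<integral>\<omega>. min 1 ((J i \<omega>)\<^sup>2) \<partial>M)"
      unfolding T_def by (intro nn_integral_eq_integral integrable_const_bound[where B = 1]) auto
    also have "(\<integral>\<omega>. min 1 ((J i \<omega>)\<^sup>2) \<partial>M) = (\<integral>y. min 1 (y\<^sup>2) \<partial>distr M borel (J i))"
      by (simp add: integral_distr)
    also have "\<dots> \<le> 8 * c i"
      using stable_law_truncated_second_moment[OF law \<alpha>] c(1) less_imp_le by blast
    finally show ?thesis by (simp add: ennreal_leI)
  qed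
  have c_tail: "summable (\<lambda>n. c (n + N))" using c(2) summable_iff_shift[of c N] by blast
  have "p * ennreal \<rho> = (\<integral>\<^sup>+\<omega>. (\<Prod>i<N. q i \<omega>) * ennreal \<rho> \<partial>M)"
    by (subst nn_integral_multc) (auto simp: head)
  also have "\<dots> \<le> (\<integral>\<^sup>+\<omega>. (\<Prod>i<N. q i \<omega>) * (\<Sum>n. T (n + N) \<omega>) \<partial>M)"
  proof (rule nn_integral_mono_AE)
    show "AE \<omega> in M. (\<Prod>i<N. q i \<omega>) * ennreal \<rho> \<le> (\<Prod>i<N. q i \<omega>) * (\<Sum>n. T (n + N) \<omega>)"
      using AE
    proof eventually_elim
      case (elim \<omega>)
      show ?case
      proof (cases "\<forall>i<N. \<bar>J i \<omega> - m i\<bar> < \<epsilon>")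
        case True
        then have "ennreal \<rho> \<le> (\<Sum>n. T (n + N) \<omega>)" using elim unfolding T_def by blast
        then show ?thesis by (rule mult_left_mono) simp
      next
        case False
        then obtain i where "i < N" "\<not> \<bar>J i \<omega> - m i\<bar> < \<epsilon>" by blast
        then have "q i \<omega> = 0" by (simp add: q_def dist_real_def abs_minus_commute)
        then have zero: "(\<Prod>i<N. q i \<omega>) = 0" using \<open>i < N\<close> by (intro prod_zero) auto
        show ?thesis unfolding zero by simp
      qed
    qed
  qed
  also have "\<dots> = (\<integral>\<^sup>+\<omega>. (\<Sum>n. (\<Prod>i<N. q i \<omega>) * T (n + N) \<omega>) \<partial>M)"
    by simp
  also have "\<dots> = (\<Sum>n. \<integral>\<^sup>+\<omega>. (\<Prod>i<N. q i \<omega>) * T (n + N) \<omega> \<partial>M)"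
    by (rule nn_integral_suminf) measurable
  also have "\<dots> = p * (\<Sum>n. \<integral>\<^sup>+\<omega>. T (n + N) \<omega> \<partial>M)"
    by (simp only: joint ennreal_suminf_cmult)
  also have "\<dots> \<le> p * (\<Sum>n. ennreal (8 * c (n + N)))"
    by (intro mult_left_mono suminf_le T_le) auto
  also have "(\<Sum>n. ennreal (8 * c (n + N))) = ennreal (8 * (\<Sum>n. c (n + N)))"
    using c(1) c_tail by (subst suminf_ennreal2) (auto simp: less_imp_le suminf_mult intro!: summable_mult)
  also have "p * ennreal (8 * (\<Sum>n. c (n + N))) < p * ennreal \<rho>"
    using c p_pos p_top suminf_nonneg[OF c_tail]
    by (intro ennreal_mult_strict_left_mono) (auto simp: ennreal_less_iff less_imp_le)
  finally show False by simp
qed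

theorem corollary4p12:
  fixes M :: "'a measure" and F :: "real \<Rightarrow> 'a measure"
    and Z :: "nat \<Rightarrow> real \<Rightarrow> 'a \<Rightarrow> real"
    and \<alpha> :: real and \<beta> \<gamma> :: "nat \<Rightarrow> real"
    and e :: "nat \<Rightarrow> 'h::{real_inner, banach, second_countable_topology}"
    and D :: "'h set" and A :: "'h \<Rightarrow> 'h"
    and x :: 'h
  assumes "orthonormal_basis e"
    and "0 < \<alpha>" and "\<alpha> < 2"
    and "stochastic_basis M F"
    and "\<And>n. symmetric_stable_process M F (Z n) \<alpha>"
    and "independent_processes M Z"
    and "\<And>n. 0 < \<beta> n"
    and "self_adjoint_on D A"
    and "\<And>n. e n \<in> D"
    and "\<And>n. A (e n) = - \<gamma> n *\<^sub>R e n"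
    and "\<And>n. 0 < \<gamma> n"
    and "filterlim \<gamma> at_top sequentially"
    and "summable (\<lambda>n. \<beta> n powr \<alpha> / \<gamma> n)"
  shows "irreducible_process M (OU_process M e \<gamma> \<beta> Z x)"
  unfolding irreducible_process_def
proof (intro allI impI)
  fix y :: 'h and r t :: real
  assume r: "0 < r" and t: "0 < t"
  note \<alpha> = assms(2,3)
  interpret stochastic_basis M F by (rule assms(4))
  interpret Z: symmetric_stable_process M F "Z n" \<alpha> for n by (rule assms(5))
  have e: "e i \<bullet> e j = (if i = j then 1 else 0)" for i j
    using assms(1) by (simp add: orthonormal_basis_def)
  define f where "f n s = exp (- \<gamma> n * (t - s)) * \<beta> n" for n s
  define J where "J n = stochastic_integral M (f n) (Z n) t" for n
  define c where "c n = \<beta> n powr \<alpha> * ((1 - exp (- (\<alpha> * \<gamma> n) * t)) / (\<alpha> * \<gamma> n))" for n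
  have "\<exists>G. G \<in> borel_measurable (\<Pi>\<^sub>M s\<in>{0..}. borel) \<and>
      has_stochastic_integral M (f n) (Z n) t (\<lambda>\<omega>. G (\<lambda>s\<in>{0..}. Z n s \<omega>))" for n
  proof -
    have "continuous_on {0..t} (f n)" unfolding f_def by (intro continuous_intros)
    then show ?thesis
      using Z.stochastic_integral_path_functional[OF \<alpha> _ less_imp_le[OF t]] by blast
  qed
  then obtain G where G: "\<And>n. G n \<in> borel_measurable (\<Pi>\<^sub>M s\<in>{0..}. borel)"
    "\<And>n. has_stochastic_integral M (f n) (Z n) t (\<lambda>\<omega>. G n (\<lambda>s\<in>{0..}. Z n s \<omega>))"
    by metis
  \<comment> \<open>The version \<open>J\<close> chosen by \<open>SOME\<close> comes with no formula
    in terms of the path of \<open>Z n\<close>; \<open>J'\<close> is one, agrees with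
    \<open>J\<close> almost surely, and inherits independence.\<close>
  define J' where "J' n \<omega> = G n (\<lambda>s\<in>{0..}. Z n s \<omega>)" for n \<omega>
  have J: "has_stochastic_integral M (f n) (Z n) t (J n)" for n
    unfolding J_def stochastic_integral_def
    by (rule someI_ex[of "has_stochastic_integral M (f n) (Z n) t"]) (use G(2) in blast)
  have [measurable]: "J n \<in> borel_measurable M" for n
    using J by (simp add: has_stochastic_integral_def)
  have J': "has_stochastic_integral M (f n) (Z n) t (J' n)" for n
    using G(2) by (simp add: J'_def[abs_def])
  have JJ': "AE \<omega> in M. \<forall>n. J n \<omega> = J' n \<omega>"
    unfolding AE_all_countable using Z.has_stochastic_integral_unique[OF J J' less_imp_le[OF t]] by blast
  have indep: "indep_vars (\<lambda>_. borel) J' UNIV"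
    using indep_vars_compose2[OF assms(6)[unfolded independent_processes_def], of G "\<lambda>_. borel"] G(1)
    by (simp add: J'_def[abs_def])
  have law: "stable_law \<alpha> (c n) (distr M borel (J' n))" for n
    using tendsto_OU_riemann_sum[OF assms(11) assms(7) \<alpha>(1) t, of n n]
    by (intro Z.stable_law_stochastic_integral[OF J' less_imp_le[OF t]]) (simp only: f_def c_def)
  have c_pos: "0 < c n" for n
    using \<alpha> assms(7,11)[of n] t by (auto simp: c_def intro!: mult_pos_pos divide_pos_pos)
  \<comment> \<open>Bounding 1 - e^(-\<alpha> \<gamma> t) by 1 reduces summability of
    \<open>c\<close> to the hypothesis.\<close>
  have c_le: "c n \<le> \<beta> n powr \<alpha> / \<gamma> n / \<alpha>" for n
  proof -
    have "c n \<le> \<beta> n powr \<alpha> * (1 / (\<alpha> * \<gamma> n))"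
      unfolding c_def using \<alpha> assms(11)[of n] by (intro mult_left_mono divide_right_mono) auto
    then show ?thesis by (simp add: mult.commute)
  qed
  have c_summable: "summable c"
    by (rule summable_comparison_test[OF _ summable_divide[OF assms(13), of \<alpha>]])
      (use c_le c_pos less_imp_le in \<open>auto simp: abs_of_pos\<close>)
  \<comment> \<open>The value the n-th integral must take for the process to sit at the centre
    \<open>y\<close>: the coordinate of \<open>y\<close> less the decayed coordinate of
    \<open>x\<close>.\<close>
  define m where "m n = y \<bullet> e n - exp (- \<gamma> n * t) * (x \<bullet> e n)" for n
  have "summable (\<lambda>n. (exp (- \<gamma> n * t) * (x \<bullet> e n))\<^sup>2)"
  proof (rule summable_comparison_test[OF _ summable_inner_orthonormal[OF e, of x]], intro exI allI impI)
    fix n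
    have "(exp (- \<gamma> n * t))\<^sup>2 \<le> 1"
      using assms(11)[of n] t by (intro power_le_one) auto
    then show "norm ((exp (- \<gamma> n * t) * (x \<bullet> e n))\<^sup>2) \<le> (x \<bullet> e n)\<^sup>2"
      using mult_right_mono[of "(exp (- \<gamma> n * t))\<^sup>2" 1 "(x \<bullet> e n)\<^sup>2"] by (simp add: power_mult_distrib)
  qed
  then have m_summable: "summable (\<lambda>n. (m n)\<^sup>2)"
    unfolding m_def by (intro summable_power2_diff summable_inner_orthonormal[OF e])
  \<comment> \<open>The cap 1 lets the truncation be removed; r^2 / 8 limits the tail to r^2 / 2 of
    the squared radius.\<close>
  define \<rho> where "\<rho> = min 1 (r\<^sup>2 / 8)"
  have \<rho>: "0 < \<rho>" "\<rho> \<le> 1" "4 * \<rho> \<le> r\<^sup>2 / 2" using r by (auto simp: \<rho>_def)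
  have "eventually (\<lambda>N. (\<Sum>n. (m (n + N))\<^sup>2) < \<rho>) sequentially"
    by (rule order_tendstoD(2)[OF suminf_exist_split2[OF m_summable] \<rho>(1)])
  \<comment> \<open>The 8 is the constant of the truncated second moment bound.\<close>
  moreover have "eventually (\<lambda>N. (\<Sum>n. c (n + N)) < \<rho> / 8) sequentially"
    by (rule order_tendstoD(2)[OF suminf_exist_split2[OF c_summable]]) (use \<rho> in simp)
  ultimately have "eventually (\<lambda>N. (\<Sum>n. (m (n + N))\<^sup>2) < \<rho> \<and> (\<Sum>n. c (n + N)) < \<rho> / 8) sequentially"
    by (rule eventually_conj)
  then obtain N where N: "(\<Sum>n. (m (n + N))\<^sup>2) < \<rho>" "(\<Sum>n. c (n + N)) < \<rho> / 8"
    using eventually_happens trivial_limit_sequentially by blast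
  \<comment> \<open>N coordinates within \<epsilon> use at most r^2 / 4 of the squared radius;
    \<open>Suc N\<close> avoids dividing by 0 when N = 0.\<close>
  define \<epsilon> where "\<epsilon> = r / (2 * sqrt (real (Suc N)))"
  have \<epsilon>: "0 < \<epsilon>" using r by (simp add: \<epsilon>_def)
  have "real N * \<epsilon>\<^sup>2 \<le> real (Suc N) * \<epsilon>\<^sup>2" by (intro mult_right_mono) auto
  also have "\<dots> = r\<^sup>2 / 4" by (simp add: \<epsilon>_def power_divide power_mult_distrib field_simps)
  finally have \<epsilon>_\<rho>: "real N * \<epsilon>\<^sup>2 + 4 * \<rho> \<le> r\<^sup>2" using \<rho>(3) zero_le_power2[of r] by linarith
  let ?X = "OU_process M e \<gamma> \<beta> Z x t"
  have X: "?X \<omega> = (\<Sum>n. (exp (- \<gamma> n * t) * (x \<bullet> e n) + J n \<omega>) *\<^sub>R e n)" for \<omega>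
    by (simp add: OU_process_def OU_coord_def J_def f_def[abs_def])
  \<comment> \<open>Measurability is what turns probability 0 into a null set below.\<close>
  have X_meas [measurable]: "?X \<in> borel_measurable M"
    unfolding X by measurable
  show "0 < measure M {\<omega> \<in> space M. ?X \<omega> \<in> ball y r}"
  proof (rule ccontr)
    assume "\<not> ?thesis"
    then have "measure M {\<omega> \<in> space M. ?X \<omega> \<in> ball y r} = 0"
      using measure_nonneg[of M] by (simp add: not_less antisym)
    then have "{\<omega> \<in> space M. ?X \<omega> \<in> ball y r} \<in> null_sets M"
      by (auto simp: null_sets_def emeasure_eq_measure)
    then have "AE \<omega> in M. ?X \<omega> \<notin> ball y r"
      by (rule AE_I') auto
    then have AE: "AE \<omega> in M. (\<forall>i<N. \<bar>J' i \<omega> - m i\<bar> < \<epsilon>) \<longrightarrow>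
        ennreal \<rho> \<le> (\<Sum>n. ennreal (min 1 ((J' (n + N) \<omega>)\<^sup>2)))"
      using JJ'
    proof eventually_elim
      case (elim \<omega>)
      show ?case
      proof (intro impI, rule ccontr)
        assume head: "\<forall>i<N. \<bar>J' i \<omega> - m i\<bar> < \<epsilon>"
          and "\<not> ennreal \<rho> \<le> (\<Sum>n. ennreal (min 1 ((J' (n + N) \<omega>)\<^sup>2)))"
        \<comment> \<open>Convergence at this sample point comes out of the estimate, so
          \<open>suminf\<close> in the process is the true sum there.\<close>
        then have "\<exists>s. (\<lambda>n. (J' n \<omega> - m n) *\<^sub>R e n) sums s \<and> norm s < r"
          using N(1) \<rho> r \<epsilon>_\<rho> m_summable
          by (intro orthonormal_series_close[OF e, where N = N and \<rho> = \<rho> and \<epsilon> = \<epsilon>]) (auto simp: not_le)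
        then obtain s where s: "(\<lambda>n. (J' n \<omega> - m n) *\<^sub>R e n) sums s" "norm s < r" by blast
        have "(\<lambda>n. (J' n \<omega> - m n) *\<^sub>R e n + (y \<bullet> e n) *\<^sub>R e n) sums (s + y)"
          by (rule sums_add[OF s(1) orthonormal_basis_expansion[OF assms(1)]])
        also have "(\<lambda>n. (J' n \<omega> - m n) *\<^sub>R e n + (y \<bullet> e n) *\<^sub>R e n)
            = (\<lambda>n. (exp (- \<gamma> n * t) * (x \<bullet> e n) + J n \<omega>) *\<^sub>R e n)"
          using elim(2) by (simp add: m_def scaleR_add_left[symmetric] add.commute)
        finally have "?X \<omega> = s + y" unfolding X by (rule sums_unique[symmetric])
        then show False using elim(1) s(2) by (simp add: dist_norm)
      qed
    qed
    have "8 * (\<Sum>n. c (n + N)) < \<rho>" using N(2) by simp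
    then show False
      using head_and_tail_not_AE[OF indep \<alpha> law c_pos c_summable _ \<epsilon>] AE by blast
  qed
qed

end
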